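(* Suppose that a linear partial monitoring game (with domain $\mathcal D$ and Legendre potential $F$ satisfying the standing assumptions in the context) has an information ratio of $(\alpha,\beta,\lambda)$ with $\lambda>1$. Then, for every $\eta>0$, $$\Lambda^*_\eta \le \alpha+\beta\left(1-\frac1\lambda\right)\left(\frac{\eta}{\lambda}\right)^{\frac{1}{\lambda-1}}.$$
   Context: A linear partial monitoring game is given by an action set $\mathcal A\subset\mathbb R^d$, a signal set $\Sigma$, a latent set $\mathcal Z$, a signal function $\Phi:\mathcal A\times\mathcal Z\to\Sigma$, written $\Phi_a(z)$, and a loss function $\ell:\mathcal Z\to[0,1]^d$. Standing assumptions. $F:\mathbb R^d\to\mathbb R\cup\{\infty\}$ is Legendre (proper, convex, lower semi-continuous, essentially smooth and essentially strictly convex). $\mathcal D\subset\operatorname{conv}(\mathcal A)$ is compact, convex and has non-empty relative interior. Moreover: (a) $1<|\mathcal A|<\infty$; (b) $\langle a,\ell(z)\rangle\in[0,1]$ for all $a\in\mathcal A$, $z\in\mathcal Z$; (c) $\mathcal D\subset\operatorname{dom}(F)=\{x\in\mathbb R^d:F(x)<\infty\}$; (d) $\operatorname{diam}(\mathcal D)=\sup_{x,y\in\mathcal D}(F(x)-F(y))<\infty$. Notation. $\mathcal P$ is the set of probability distributions on $\mathcal A$ and $\mathcal P_+=\{p\in\mathcal P: p(a)>0\ \forall a\in\mathcal A\}$. $F^\star(u)=\sup_{x\in\mathbb R^d}\langle u,x\rangle-F(x)$. Bregman divergences: $\operatorname{D}(p,q)=F(p)-F(q)-\langle\nabla F(q),p-q\rangle$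 and $\operatorname{D}_\star(x,y)=F^\star(x)-F^\star(y)-\langle\nabla F^\star(y),x-y\rangle$. If $F$ is not differentiable at $q$, then $\langle\nabla F(q),p-q\rangle$ is read as the one-sided directional derivative $\lim_{h\to0^+}(F(q+h(p-q))-F(q))/h$. $\operatorname{dom}(\nabla F)$ is the set where $F$ is differentiable. For $q\in\mathcal D\cap\operatorname{dom}(\nabla F)$, $\Psi_q(x)=\operatorname{D}_\star(\nabla F(q)-x,\nabla F(q))$. $\mathcal V$ is the set of finitely supported probability distributions on $\mathcal Z\times\mathcal D$. $\mathcal G$ is the set of all functions from $\mathcal A\times\Sigma$ to $\mathbb R^d$. Information ratio. For $\alpha\in\mathbb R$, $\beta\ge0$, $\lambda\geq 1$, the game has an information ratio of $(\alpha,\beta,\lambda)$ if for any $\nu\in\mathcal V$ there exists $p\in\mathcal P$ such that when $(Z,A^*,A)$ has law $\nu\otimes p$ (i.e. $(Z,A^* )\sim\nu$ and $A\sim p$ independently), $$\mathbb E[\langle A-A^*,\ell(Z)\rangle]\le\alpha+\beta^{1-1/\lambda}\,\big(\mathbb E[\operatorname{D}(\mathbb E[A^*\mid\Phi_A(Z),A],\mathbb E[A^*])]\big)^{1/\lambda}.$$ Optimisation problem. For $\eta>0$, $q\in\mathcal D\cap\operatorname{dom}(\nabla F)$, $z\in\mathcal Z$, $a^*\in\mathcal D$, $p\in\mathcal P_+$, $g\in\mathcal G$, $$\Lambda_{q,\eta}(z,a^*,p,g)=\sum_{a\in\mathcal A}p(a)\langle a-a^*,\ell(z)\rangle+\Big\langle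 a^*-q,\sum_{a\in\mathcal A}g(a,\Phi_a(z))\Big\rangle+\frac1\eta\sum_{a\in\mathcal A}p(a)\Psi_q\left(\frac{\eta g(a,\Phi_a(z))}{p(a)}\right),$$ $$\Lambda^*_{q,\eta}=\inf_{p\in\mathcal P_+,\,g\in\mathcal G}\ \sup_{z\in\mathcal Z,\,a^*\in\mathcal D}\Lambda_{q,\eta}(z,a^*,p,g),\qquad \Lambda^*_\eta=\sup_{q\in\mathcal D\cap\operatorname{dom}(\nabla F)}\Lambda^*_{q,\eta}.$$ *)

theory Defs
  imports "HOL-Probability.Probability"
begin

section \<open>Convex analysis for extended-real-valued functions\<close>

definition edom :: "('v \<Rightarrow> ereal) \<Rightarrow> 'v set" where
  "edom F = {x. F x < \<infinity>}"

definition proper :: "('v \<Rightarrow> ereal) \<Rightarrow> bool" where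
  "proper F \<longleftrightarrow> (\<forall>x. F x \<noteq> -\<infinity>) \<and> edom F \<noteq> {}"

text \<open>No \<open>\<infinity> - \<infinity>\<close> arises below for functions that never take the value \<open>-\<infinity>\<close>.\<close>

definition econvex :: "('v::real_vector \<Rightarrow> ereal) \<Rightarrow> bool" where
  "econvex F \<longleftrightarrow>
     (\<forall>x y. \<forall>t\<in>{0..1::real}. F ((1 - t) *\<^sub>R x + t *\<^sub>R y) \<le> ereal (1 - t) * F x + ereal t * F y)"

definition lower_semicontinuous :: "('v::topological_space \<Rightarrow> ereal) \<Rightarrow> bool" where
  "lower_semicontinuous F \<longleftrightarrow> (\<forall>x. F x \<le> Liminf (at x) F)"

text \<open>Differentiability at a point requires finiteness on a neighbourhood, which is not visible
  after applying \<^const>\<open>real_of_ereal\<close> (it sends \<open>\<infinity>\<close> to \<open>0\<close>); hence the interior.\<close>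

definition dom_grad :: "('v::real_inner \<Rightarrow> ereal) \<Rightarrow> 'v set" where
  "dom_grad F = {x \<in> interior (edom F). (\<lambda>y. real_of_ereal (F y)) differentiable (at x)}"

definition grad :: "('v::real_inner \<Rightarrow> ereal) \<Rightarrow> 'v \<Rightarrow> 'v" where
  "grad F x = (THE v. GDERIV (\<lambda>y. real_of_ereal (F y)) x :> v)"

definition subdiff :: "('v::real_inner \<Rightarrow> ereal) \<Rightarrow> 'v \<Rightarrow> 'v set" where
  "subdiff F x = {v. \<forall>y. F y \<ge> F x + ereal (v \<bullet> (y - x))}"

definition strictly_convex_on :: "'v::real_vector set \<Rightarrow> ('v \<Rightarrow> ereal) \<Rightarrow> bool" where
  "strictly_convex_on C F \<longleftrightarrow>
     (\<forall>x\<in>C. \<forall>y\<in>C. \<forall>t\<in>{0<..<1::real}. x \<noteq> y \<longrightarrow>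
        F ((1 - t) *\<^sub>R x + t *\<^sub>R y) < ereal (1 - t) * F x + ereal t * F y)"

text \<open>The next two notions are those of Rockafellar, \<^emph>\<open>Convex Analysis\<close>, Section 26.\<close>

definition essentially_smooth :: "('v::real_inner \<Rightarrow> ereal) \<Rightarrow> bool" where
  "essentially_smooth F \<longleftrightarrow>
     interior (edom F) \<noteq> {} \<and>
     interior (edom F) \<subseteq> dom_grad F \<and>
     (\<forall>X x. (\<forall>n::nat. X n \<in> interior (edom F)) \<longrightarrow> X \<longlonglongrightarrow> x \<longrightarrow> x \<in> frontier (interior (edom F)) \<longrightarrow>
        filterlim (\<lambda>n. norm (grad F (X n))) at_top sequentially)"

definition essentially_strictly_convex :: "('v::real_inner \<Rightarrow> ereal) \<Rightarrow> bool" where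
  "essentially_strictly_convex F \<longleftrightarrow>
     (\<forall>C. convex C \<longrightarrow> C \<subseteq> {x. subdiff F x \<noteq> {}} \<longrightarrow> strictly_convex_on C F)"

definition legendre :: "('v::real_inner \<Rightarrow> ereal) \<Rightarrow> bool" where
  "legendre F \<longleftrightarrow> proper F \<and> econvex F \<and> lower_semicontinuous F \<and>
     essentially_smooth F \<and> essentially_strictly_convex F"

definition conjugate :: "('v::real_inner \<Rightarrow> ereal) \<Rightarrow> 'v \<Rightarrow> ereal" where
  "conjugate F u = (SUP x. ereal (u \<bullet> x) - F x)"

definition dir_deriv :: "('v::real_inner \<Rightarrow> ereal) \<Rightarrow> 'v \<Rightarrow> 'v \<Rightarrow> ereal" where
  "dir_deriv F q v = Lim (at_right 0) (\<lambda>h::real. (F (q + h *\<^sub>R v) - F q) / ereal h)"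

text \<open>Taken with \<open>F\<close> this is \<open>D\<close>; taken with \<open>conjugate F\<close> it is \<open>D\<^sub>\<star>\<close>. The directional derivative
  may be \<open>-\<infinity>\<close>, so that the divergence may be \<open>\<infinity>\<close> even where \<open>F\<close> is finite.\<close>

definition bregman :: "('v::real_inner \<Rightarrow> ereal) \<Rightarrow> 'v \<Rightarrow> 'v \<Rightarrow> ereal" where
  "bregman F p q = F p - F q -
     (if q \<in> dom_grad F then ereal (grad F q \<bullet> (p - q)) else dir_deriv F q (p - q))"


section \<open>Auxiliary notions\<close>

text \<open>Conditional expectation of \<open>Y\<close> given \<open>X\<close> for a discrete law \<open>M\<close> on the sample space, as a
  function of the outcome; only values at outcomes in \<^term>\<open>set_pmf M\<close> are meaningful.\<close>

definition pmf_cond_exp ::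
    "'w pmf \<Rightarrow> ('w \<Rightarrow> 'v::{banach,second_countable_topology}) \<Rightarrow> ('w \<Rightarrow> 'x) \<Rightarrow> 'w \<Rightarrow> 'v" where
  "pmf_cond_exp M Y X w = measure_pmf.expectation (cond_pmf M {w'. X w' = X w}) Y"

definition ereal_powr :: "ereal \<Rightarrow> real \<Rightarrow> ereal" where
  "ereal_powr x r = (if x = \<infinity> then \<infinity> else ereal (real_of_ereal x powr r))"


section \<open>Linear partial monitoring games\<close>

locale linear_pm_game =
  fixes A :: "(real ^ 'n) set"
    and Sig :: "'s set"
    and Z :: "'z set"
    and Phi :: "real ^ 'n \<Rightarrow> 'z \<Rightarrow> 's"
    and loss :: "'z \<Rightarrow> real ^ 'n"
    and F :: "real ^ 'n \<Rightarrow> ereal"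
    and D :: "(real ^ 'n) set"
  assumes signal_in: "\<And>a z. a \<in> A \<Longrightarrow> z \<in> Z \<Longrightarrow> Phi a z \<in> Sig"
    and loss_in: "\<And>z i. z \<in> Z \<Longrightarrow> 0 \<le> loss z $ i \<and> loss z $ i \<le> 1"
    and legendre_F: "legendre F"
    and D_subset: "D \<subseteq> convex hull A"
    and compact_D: "compact D"
    and convex_D: "convex D"
    and rel_interior_D: "rel_interior D \<noteq> {}"
    and finite_A: "finite A"
    and card_A: "1 < card A"
    and inner_loss: "\<And>a z. a \<in> A \<Longrightarrow> z \<in> Z \<Longrightarrow> 0 \<le> a \<bullet> loss z \<and> a \<bullet> loss z \<le> 1"
    and D_dom: "D \<subseteq> edom F"
    and diam_finite: "(SUP x\<in>D. SUP y\<in>D. F x - F y) < \<infinity>"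
begin

definition Prob :: "(real ^ 'n) pmf set" where
  "Prob = {p. set_pmf p \<subseteq> A}"

definition Prob_plus :: "(real ^ 'n) pmf set" where
  "Prob_plus = {p. set_pmf p = A}"

definition V :: "('z \<times> (real ^ 'n)) pmf set" where
  "V = {\<nu>. finite (set_pmf \<nu>) \<and> set_pmf \<nu> \<subseteq> Z \<times> D}"

definition expected_regret :: "('z \<times> (real ^ 'n)) pmf \<Rightarrow> (real ^ 'n) pmf \<Rightarrow> real" where
  "expected_regret \<nu> p =
     measure_pmf.expectation (pair_pmf \<nu> p) (\<lambda>((z, a'), a). (a - a') \<bullet> loss z)"

text \<open>An outcome is a triple \<open>((z, a\<^sup>*), a)\<close>. The divergence is nonnegative by convexity of \<open>F\<close>, so
  that truncation by \<^const>\<open>e2ennreal\<close> is harmless.\<close>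

definition expected_gain :: "('z \<times> (real ^ 'n)) pmf \<Rightarrow> (real ^ 'n) pmf \<Rightarrow> ereal" where
  "expected_gain \<nu> p =
     (let M = pair_pmf \<nu> p;
          Astar = (\<lambda>((z, a'), a). a');
          Obs = (\<lambda>((z, a'), a). (Phi a z, a))
      in enn2ereal (\<integral>\<^sup>+ w. e2ennreal
           (bregman F (pmf_cond_exp M Astar Obs w) (measure_pmf.expectation M Astar)) \<partial>measure_pmf M))"

text \<open>The case distinction gives \<open>0\<^sup>0 = 1\<close> for \<open>\<beta> = 0\<close> and \<open>\<lambda> = 1\<close>, whereas
  \<^prop>\<open>0 powr 0 = (0::real)\<close>.\<close>

definition has_information_ratio :: "real \<Rightarrow> real \<Rightarrow> real \<Rightarrow> bool" where
  "has_information_ratio \<alpha> \<beta> lam \<longleftrightarrow>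
     (\<forall>\<nu>\<in>V. \<exists>p\<in>Prob.
        ereal (expected_regret \<nu> p) \<le>
          ereal \<alpha> + ereal (if lam = 1 then 1 else \<beta> powr (1 - 1 / lam)) *
            ereal_powr (expected_gain \<nu> p) (1 / lam))"

definition Psi :: "real ^ 'n \<Rightarrow> real ^ 'n \<Rightarrow> ereal" where
  "Psi q x = bregman (conjugate F) (grad F q - x) (grad F q)"

text \<open>Functions \<open>g\<close> are total on the types; only their values on \<^term>\<open>A \<times> Sig\<close> are used.\<close>

definition Lambda ::
    "real ^ 'n \<Rightarrow> real \<Rightarrow> 'z \<Rightarrow> real ^ 'n \<Rightarrow> (real ^ 'n) pmf \<Rightarrow> (real ^ 'n \<Rightarrow> 's \<Rightarrow> real ^ 'n) \<Rightarrow> ereal" where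
  "Lambda q \<eta> z a' p g =
     ereal (\<Sum>a\<in>A. pmf p a * ((a - a') \<bullet> loss z))
     + ereal ((a' - q) \<bullet> (\<Sum>a\<in>A. g a (Phi a z)))
     + ereal (1 / \<eta>) * (\<Sum>a\<in>A. ereal (pmf p a) * Psi q ((\<eta> / pmf p a) *\<^sub>R g a (Phi a z)))"

definition Lambda_star_at :: "real ^ 'n \<Rightarrow> real \<Rightarrow> ereal" where
  "Lambda_star_at q \<eta> =
     (INF (p, g) \<in> Prob_plus \<times> UNIV. SUP (z, a') \<in> Z \<times> D. Lambda q \<eta> z a' p g)"

definition Lambda_star :: "real \<Rightarrow> ereal" where
  "Lambda_star \<eta> = (SUP q \<in> D \<inter> dom_grad F. Lambda_star_at q \<eta>)"

end

end

theory Submission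
  imports Defs
begin

text \<open>Writing \<open>F\<^sup>\<star>\<close> as a supremum of affine functions turns \<open>\<Lambda>\<close>, as a function of \<open>(p, g)\<close>, into a
  supremum of affine functions indexed by \<open>z\<close>, \<open>a\<^sup>*\<close> and points \<open>x a\<close> of the domain of \<open>F\<close>. On a
  compact set of pairs \<open>(p, g)\<close>, with \<open>p\<close> bounded away from \<open>0\<close> and \<open>g\<close> bounded, a Ky Fan argument
  reduces the bound to finite mixtures of these functions, that is, to a law \<open>\<nu>\<close> of \<open>(z, a\<^sup>*)\<close>. There
  \<open>p\<close> comes from the information ratio and \<open>g(a, \<sigma>) = p(a) (\<nabla>F(q) - \<nabla>F(y)) / \<eta>\<close>, with \<open>y\<close> the posterior
  mean of \<open>a\<^sup>*\<close>; the objective becomes regret minus \<open>1/\<eta>\<close> times the expected divergence of \<open>y\<close> from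
  \<open>q\<close>, which dominates the information gain, and Young's inequality concludes.

  Since \<open>\<nabla>F\<close> may blow up on \<open>D\<close>, and \<open>F\<close> need not even be continuous there, \<open>\<nu>\<close> is first
  pushed towards \<open>q\<close> by a factor \<open>e\<close>. The gradients are then bounded uniformly in \<open>\<nu>\<close>, and monotonicity
  of \<open>\<nabla>F\<close> keeps the loss of order \<open>e\<close>.\<close>

section \<open>A minimax theorem for affine functions\<close>

text \<open>The image of \<open>K\<close> under \<open>(u, v)\<close> is compact and convex in the
  plane. If it missed the closed quadrant below \<open>(c, c)\<close>, a separating line would have
  a nonnegative normal, whose normalisation is a weight violating \<open>mix\<close>. Affinity is
  expressed only through values of \<open>u\<close> and \<open>v\<close>, so \<open>K\<close> may
  lie in a space without linear structure.\<close>

lemma two_function_minimax: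
  fixes u v :: "'x::topological_space \<Rightarrow> real"
  assumes "compact K"
    and "continuous_on UNIV u" "continuous_on UNIV v"
    and comb: "\<And>x y t. x \<in> K \<Longrightarrow> y \<in> K \<Longrightarrow> t \<in> {0..1} \<Longrightarrow>
      \<exists>z\<in>K. u z = (1 - t) * u x + t * u y \<and> v z = (1 - t) * v x + t * v y"
    and mix: "\<And>t. t \<in> {0..1} \<Longrightarrow> \<exists>x\<in>K. (1 - t) * u x + t * v x \<le> c"
  shows "\<exists>x\<in>K. u x \<le> c \<and> v x \<le> c"
proof (rule ccontr)
  assume neg: "\<not> ?thesis"
  define T where "T = (\<lambda>x. (u x, v x)) ` K"
  have "compact T"
    unfolding T_def using assms(1-3)
    by (intro compact_continuous_image continuous_on_Pair) (auto intro: continuous_on_subset)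
  have "T \<noteq> {}"
    using mix[of 0] by (auto simp: T_def)
  have "convex T"
    unfolding convex_alt
  proof (intro ballI allI impI)
    fix r s :: "real \<times> real" and t :: real
    assume "r \<in> T" "s \<in> T" "0 \<le> t \<and> t \<le> 1"
    then obtain x y where "x \<in> K" "y \<in> K" and [simp]: "r = (u x, v x)" "s = (u y, v y)"
      by (auto simp: T_def)
    with comb[of x y t] \<open>0 \<le> t \<and> t \<le> 1\<close> obtain z where "z \<in> K"
      "u z = (1 - t) * u x + t * u y" "v z = (1 - t) * v x + t * v y"
      by auto
    then show "(1 - t) *\<^sub>R r + t *\<^sub>R s \<in> T"
      by (force simp: T_def)
  qed
  moreover have "({..c} \<times> {..c}) \<inter> T = {}"
    using neg by (auto simp: T_def)
  moreover have "convex ({..c} \<times> {..c})" "closed ({..c} \<times> {..c})"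
    by (auto intro: closed_Times convex_Times)
  ultimately obtain a b where sep: "\<And>s. s \<in> {..c} \<times> {..c} \<Longrightarrow> a \<bullet> s < b" "\<And>s. s \<in> T \<Longrightarrow> a \<bullet> s > b"
    using separating_hyperplane_closed_compact[of "{..c} \<times> {..c}" T] \<open>compact T\<close> \<open>T \<noteq> {}\<close>
    by metis
  obtain a1 a2 where [simp]: "a = (a1, a2)" by force
  have quadrant: "a1 * (c - m) + a2 * (c - n) < b" if "m \<ge> 0" "n \<ge> 0" for m n
    using sep(1)[of "(c - m, c - n)"] that by simp
  \<comment> \<open>The quadrant is unbounded below in each coordinate: a negative normal coordinate
    would let the functional reach \<open>b\<close> at the depth \<open>m\<close>.\<close>
  have "a1 \<ge> 0"
  proof (rule ccontr)
    assume "\<not> a1 \<ge> 0"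
    then have "a1 < 0" by simp
    define m where "m = max 0 ((b - a1 * c - a2 * c) / - a1)"
    have "b - a1 * c - a2 * c \<le> m * - a1"
      using \<open>a1 < 0\<close> by (subst pos_divide_le_eq[symmetric]) (auto simp: m_def)
    then show False
      using quadrant[of m 0] by (simp add: m_def algebra_simps)
  qed
  moreover have "a2 \<ge> 0"
  proof (rule ccontr)
    assume "\<not> a2 \<ge> 0"
    then have "a2 < 0" by simp
    define m where "m = max 0 ((b - a1 * c - a2 * c) / - a2)"
    have "b - a1 * c - a2 * c \<le> m * - a2"
      using \<open>a2 < 0\<close> by (subst pos_divide_le_eq[symmetric]) (auto simp: m_def)
    then show False
      using quadrant[of 0 m] by (simp add: m_def algebra_simps)
  qed
  \<comment> \<open>A zero normal would give \<open>0 < b\<close> on the quadrant and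
    \<open>b < 0\<close> on \<open>T\<close>.\<close>
  moreover have "\<not> (a1 = 0 \<and> a2 = 0)"
    using quadrant[of 0 0] sep(2) \<open>T \<noteq> {}\<close> by force
  ultimately have pos: "a1 + a2 > 0" by linarith
  define t where "t = a2 / (a1 + a2)"
  have "t \<in> {0..1}"
    using \<open>a1 \<ge> 0\<close> \<open>a2 \<ge> 0\<close> pos by (simp add: t_def)
  from mix[OF this] obtain x where x: "x \<in> K" "(1 - t) * u x + t * v x \<le> c" by blast
  have "a1 * u x + a2 * v x = (a1 + a2) * ((1 - t) * u x + t * v x)"
  proof -
    have "(a1 + a2) * t = a2"
      using pos by (simp add: t_def)
    then have "(a1 + a2) * (1 - t) = a1"
      by (simp add: right_diff_distrib)
    with \<open>(a1 + a2) * t = a2\<close> show ?thesis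
      by (metis distrib_left mult.assoc)
  qed
  also have "\<dots> \<le> (a1 + a2) * c"
    using x(2) pos by (intro mult_left_mono) auto
  also have "\<dots> < b"
    using quadrant[of 0 0] by (simp add: algebra_simps)
  finally show False
    using sep(2)[of "(u x, v x)"] x(1) by (auto simp: T_def)
qed

text \<open>Induction on \<open>S\<close> with \<open>K\<close> arbitrary: \<open>K\<close> is cut
  down to the sublevel set of the new function \<open>f j\<close>, and the mixture hypothesis for
  this smaller set follows from the two-function case applied to a mixture over \<open>S\<close> and
  \<open>f j\<close>.\<close>

lemma finite_affine_minimax:
  fixes f :: "'i \<Rightarrow> 'x::topological_space \<Rightarrow> real"
  assumes "finite S" "compact K" "K \<noteq> {}"
    and "\<And>i. i \<in> S \<Longrightarrow> continuous_on UNIV (f i)"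
    and "\<And>x y t. x \<in> K \<Longrightarrow> y \<in> K \<Longrightarrow> t \<in> {0..1} \<Longrightarrow>
      \<exists>z\<in>K. \<forall>i\<in>S. f i z = (1 - t) * f i x + t * f i y"
    and "\<And>w. (\<And>i. i \<in> S \<Longrightarrow> 0 \<le> w i) \<Longrightarrow> sum w S = 1 \<Longrightarrow> \<exists>x\<in>K. (\<Sum>i\<in>S. w i * f i x) \<le> c"
  shows "\<exists>x\<in>K. \<forall>i\<in>S. f i x \<le> c"
  using assms
proof (induction S arbitrary: K rule: finite_induct)
  case empty
  then show ?case by auto
next
  case (insert j S)
  note comb = insert.prems(4) and mix = insert.prems(5)
  define K' where "K' = K \<inter> {x. f j x \<le> c}"
  have "\<exists>x\<in>K'. \<forall>i\<in>S. f i x \<le> c"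
  proof (rule insert.IH)
    have "closed {x. f j x \<le> c}"
      by (intro closed_Collect_le continuous_on_const insert.prems) simp
    then show "compact K'"
      using insert.prems(1) by (simp add: K'_def compact_Int_closed)
    \<comment> \<open>The point mass at \<open>j\<close> is an admissible weight and yields a point
      of \<open>K'\<close>.\<close>
    have "\<exists>x\<in>K. (\<Sum>i\<in>insert j S. of_bool (i = j) * f i x) \<le> c"
      using insert.hyps by (intro mix) (auto simp: of_bool_def)
    moreover have "(\<Sum>i\<in>insert j S. of_bool (i = j) * f i x) = f j x" for x
    proof -
      have "(\<Sum>i\<in>S. of_bool (i = j) * f i x) = 0"
        using insert.hyps by (intro sum.neutral) auto
      then show ?thesis using insert.hyps by simp
    qed
    ultimately show "K' \<noteq> {}"
      by (auto simp: K'_def)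
    show "continuous_on UNIV (f i)" if "i \<in> S" for i
      using insert.prems(3) that by simp
    show "\<exists>z\<in>K'. \<forall>i\<in>S. f i z = (1 - t) * f i x + t * f i y"
      if "x \<in> K'" "y \<in> K'" "t \<in> {0..1}" for x y t
    proof -
      have "x \<in> K" "y \<in> K"
        using that by (auto simp: K'_def)
      from comb[OF this that(3)] obtain z
        where z: "z \<in> K" "\<forall>i\<in>insert j S. f i z = (1 - t) * f i x + t * f i y" by blast
      have "f j z \<le> c"
        using z that convex_bound_le[of "f j x" c "f j y" "1 - t" t] by (auto simp: K'_def)
      with z show ?thesis by (auto simp: K'_def)
    qed
    show "\<exists>x\<in>K'. (\<Sum>i\<in>S. w i * f i x) \<le> c"
      if w: "\<And>i. i \<in> S \<Longrightarrow> 0 \<le> w i" "sum w S = 1" for w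
    proof -
      have "\<exists>x\<in>K. (\<Sum>i\<in>S. w i * f i x) \<le> c \<and> f j x \<le> c"
      proof (rule two_function_minimax)
        show "compact K" by fact
        show "continuous_on UNIV (\<lambda>x. \<Sum>i\<in>S. w i * f i x)"
          using insert.prems(3) by (intro continuous_on_sum continuous_on_mult_left) simp
        show "continuous_on UNIV (f j)"
          using insert.prems(3) by simp
        fix t :: real assume t: "t \<in> {0..1}"
        {
          fix x y assume "x \<in> K" "y \<in> K"
          from comb[OF this t] obtain z where "z \<in> K"
            "\<forall>i\<in>insert j S. f i z = (1 - t) * f i x + t * f i y" by blast
          moreover from this have "(\<Sum>i\<in>S. w i * f i z) =
              (\<Sum>i\<in>S. (1 - t) * (w i * f i x) + t * (w i * f i y))"
            by (intro sum.cong) (simp_all add: right_diff_distrib' distrib_left mult.left_commute)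
          then have "(\<Sum>i\<in>S. w i * f i z) =
              (1 - t) * (\<Sum>i\<in>S. w i * f i x) + t * (\<Sum>i\<in>S. w i * f i y)"
            by (simp add: sum_distrib_left sum.distrib)
          ultimately show "\<exists>z\<in>K. (\<Sum>i\<in>S. w i * f i z) =
              (1 - t) * (\<Sum>i\<in>S. w i * f i x) + t * (\<Sum>i\<in>S. w i * f i y) \<and>
              f j z = (1 - t) * f j x + t * f j y"
            by blast
        }
        \<comment> \<open>A mixture of \<open>f j\<close> and the \<open>w\<close>-mixture is again
          a mixture over \<open>insert j S\<close>, so \<open>mix\<close> applies to it.\<close>
        define w' where "w' i = (if i = j then t else (1 - t) * w i)" for i
        have w'_j: "w' j = t"
          by (simp add: w'_def)
        have eq: "(\<Sum>i\<in>S. w' i * h i) = (1 - t) * (\<Sum>i\<in>S. w i * h i)" for h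
          unfolding sum_distrib_left using insert.hyps by (intro sum.cong) (auto simp: w'_def)
        have "\<exists>x\<in>K. (\<Sum>i\<in>insert j S. w' i * f i x) \<le> c"
        proof (rule mix)
          show "0 \<le> w' i" if "i \<in> insert j S" for i
            using that w t by (auto simp: w'_def)
          show "sum w' (insert j S) = 1"
            using insert.hyps eq[of "\<lambda>_. 1"] w by (simp add: w'_def)
        qed
        then show "\<exists>x\<in>K. (1 - t) * (\<Sum>i\<in>S. w i * f i x) + t * f j x \<le> c"
          using insert.hyps eq[of "\<lambda>i. f i _"] by (simp add: w'_j add.commute)
      qed
      then show ?thesis by (auto simp: K'_def)
    qed
  qed
  then show ?case by (auto simp: K'_def)
qed

text \<open>Each sublevel set is closed, so by compactness of \<open>K\<close> the finite
  intersection property reduces an arbitrary index set to a finite one.\<close>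

lemma affine_minimax:
  fixes f :: "'i \<Rightarrow> 'x::topological_space \<Rightarrow> real"
  assumes "compact K" "K \<noteq> {}"
    and cont: "\<And>i. i \<in> I \<Longrightarrow> continuous_on UNIV (f i)"
    and comb: "\<And>x y t. x \<in> K \<Longrightarrow> y \<in> K \<Longrightarrow> t \<in> {0..1} \<Longrightarrow>
      \<exists>z\<in>K. \<forall>i\<in>I. f i z = (1 - t) * f i x + t * f i y"
    and mix: "\<And>S w. finite S \<Longrightarrow> S \<subseteq> I \<Longrightarrow> (\<And>i. i \<in> S \<Longrightarrow> 0 \<le> w i) \<Longrightarrow> sum w S = 1 \<Longrightarrow>
      \<exists>x\<in>K. (\<Sum>i\<in>S. w i * f i x) \<le> c"
  shows "\<exists>x\<in>K. \<forall>i\<in>I. f i x \<le> c"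
proof -
  have "K \<inter> (\<Inter>i\<in>I. {x. f i x \<le> c}) \<noteq> {}"
  proof (rule compact_imp_fip_image)
    show "compact K" by fact
    show "closed {x. f i x \<le> c}" if "i \<in> I" for i
      using cont[OF that] by (intro closed_Collect_le continuous_on_const)
    fix S assume S: "finite S" "S \<subseteq> I"
    have "\<exists>x\<in>K. \<forall>i\<in>S. f i x \<le> c"
    proof (rule finite_affine_minimax)
      show "continuous_on UNIV (f i)" if "i \<in> S" for i
        using cont S that by blast
      show "\<exists>z\<in>K. \<forall>i\<in>S. f i z = (1 - t) * f i x + t * f i y"
        if "x \<in> K" "y \<in> K" "t \<in> {0..1}" for x y t
        using comb[OF that] S by blast
    qed (use S assms(1,2) mix in auto)
    then show "K \<inter> (\<Inter>i\<in>S. {x. f i x \<le> c}) \<noteq> {}" by auto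
  qed
  then show ?thesis by auto
qed

section \<open>Compact boxes of functions and decoupled suprema\<close>

text \<open>Tychonoff's theorem: the topology on a function type is the product topology.\<close>

lemma compact_function_box:
  fixes S :: "'a \<Rightarrow> 'b::topological_space set"
  assumes "\<And>x. compact (S x)"
  shows "compact {f. \<forall>x. f x \<in> S x}"
proof -
  have "compactin (product_topology (\<lambda>_. euclidean) UNIV) (PiE UNIV S)"
    using assms by (simp add: compactin_PiE compactin_euclidean_iff)
  moreover have "PiE UNIV S = {f. \<forall>x. f x \<in> S x}" by (auto simp: PiE_def Pi_def)
  ultimately show ?thesis
    by (simp add: euclidean_product_topology compactin_euclidean_iff)
qed

text \<open>The points \<open>x a\<close> vary independently, so the supremum of the sum is the sum
  of the suprema. The joint bound also makes each single supremum finite. This is what later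
  reassembles conjugates from their affine minorants.\<close>

lemma separable_sup:
  fixes t :: "'a \<Rightarrow> 'b \<Rightarrow> real"
  assumes "finite A" "X \<noteq> {}" and m: "\<And>a. a \<in> A \<Longrightarrow> 0 < m a"
    and le: "\<And>x. (\<And>a. x a \<in> X) \<Longrightarrow> (\<Sum>a\<in>A. m a * t a (x a)) \<le> c"
  shows "\<exists>s. (\<forall>a\<in>A. \<forall>x\<in>X. t a x \<le> s a) \<and> (\<Sum>a\<in>A. m a * s a) \<le> c"
proof (intro exI conjI ballI)
  obtain x0 where x0: "x0 \<in> X" using assms(2) by blast
  let ?s = "\<lambda>a. SUP x\<in>X. t a x"
  have bdd: "bdd_above (t a ` X)" if a: "a \<in> A" for a
  proof (rule bdd_aboveI2)
    fix x assume "x \<in> X"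
    \<comment> \<open>Only the coordinate \<open>a\<close> varies; all others are frozen at
      \<open>x0\<close>.\<close>
    then have "(\<Sum>b\<in>A. m b * t b (((\<lambda>_. x0)(a := x)) b)) \<le> c"
      using x0 by (intro le) auto
    also have "(\<Sum>b\<in>A. m b * t b (((\<lambda>_. x0)(a := x)) b)) = m a * t a x + (\<Sum>b\<in>A - {a}. m b * t b x0)"
      using a assms(1) by (subst sum.remove[of A a]) (auto intro!: sum.cong)
    finally show "t a x \<le> (c - (\<Sum>b\<in>A - {a}. m b * t b x0)) / m a"
      using m[OF a] by (simp add: pos_le_divide_eq mult.commute)
  qed
  show "t a x \<le> ?s a" if "a \<in> A" "x \<in> X" for a x
    using that bdd by (intro cSUP_upper) auto
  show "(\<Sum>a\<in>A. m a * ?s a) \<le> c"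
  proof (rule field_le_epsilon)
    fix e :: real assume "0 < e"
    \<comment> \<open>The slack per coordinate is chosen so that its weighted total is at most
      \<open>e\<close>; the summand 1 keeps the denominator positive even for empty
      \<open>A\<close>.\<close>
    define d where "d = e / (1 + sum m A)"
    have "0 \<le> sum m A"
      using m by (intro sum_nonneg) (auto intro: less_imp_le)
    with \<open>0 < e\<close> have d: "0 < d" "d * sum m A \<le> e"
      by (auto simp: d_def field_simps)
    have "\<exists>x\<in>X. a \<in> A \<longrightarrow> ?s a - d < t a x" for a
    proof (cases "a \<in> A")
      case True
      then have "\<exists>x\<in>X. ?s a - d < t a x"
        using d(1) by (subst less_cSUP_iff[symmetric]) (auto intro: bdd simp: assms(2))
      then show ?thesis by blast
    qed (use x0 in auto)
    then obtain x where x: "\<And>a. x a \<in> X" "\<And>a. a \<in> A \<Longrightarrow> ?s a - d < t a (x a)"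
      by metis
    have "(\<Sum>a\<in>A. m a * ?s a) \<le> (\<Sum>a\<in>A. m a * (t a (x a) + d))"
      using x(2) m by (intro sum_mono mult_left_mono) (auto intro: less_imp_le simp: diff_less_eq)
    also have "\<dots> = (\<Sum>a\<in>A. m a * t a (x a)) + d * sum m A"
      by (simp add: distrib_left sum.distrib sum_distrib_left mult.commute)
    also have "\<dots> \<le> c + e"
      using le[of x] x(1) d(2) by (intro add_mono) auto
    finally show "(\<Sum>a\<in>A. m a * ?s a) \<le> c + e" .
  qed
qed

section \<open>Convex functions and their conjugates\<close>

text \<open>The description in \<open>grad\<close> is well defined: the derivative is represented by
  the vector \<open>adjoint f' 1\<close>, and derivatives are unique.\<close>

lemma dom_grad_gderiv:
  fixes F :: "'v::euclidean_space \<Rightarrow> ereal"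
  assumes "x \<in> dom_grad F"
  shows "GDERIV (\<lambda>y. real_of_ereal (F y)) x :> grad F x"
proof -
  let ?f = "\<lambda>y. real_of_ereal (F y)"
  obtain f' where f': "(?f has_derivative f') (at x)"
    using assms by (auto simp: dom_grad_def differentiable_def)
  then have lin: "linear f'"
    by (simp add: has_derivative_linear)
  have "f' h = h \<bullet> adjoint f' 1" for h
    using adjoint_works[OF lin, of h 1] by simp
  then have "f' = (\<lambda>h. h \<bullet> adjoint f' 1)" by blast
  with f' have "GDERIV ?f x :> adjoint f' 1"
    unfolding gderiv_def by metis
  moreover have "v = w" if "GDERIV ?f x :> v" "GDERIV ?f x :> w" for v w
  proof -
    have "(\<lambda>h. h \<bullet> v) = (\<lambda>h. h \<bullet> w)"
      using that unfolding gderiv_def by (rule has_derivative_unique)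
    then have "\<forall>h. h \<bullet> v = h \<bullet> w"
      by (auto dest: fun_cong)
    then show ?thesis
      by (simp only: vector_eq_ldot)
  qed
  ultimately show ?thesis
    unfolding grad_def by (metis (no_types, lifting) theI)
qed

lemma gderiv_directional_limit:
  fixes f :: "'v::real_inner \<Rightarrow> real"
  assumes "GDERIV f x :> g"
  shows "((\<lambda>h. (f (x + h *\<^sub>R v) - f x) / h) \<longlongrightarrow> g \<bullet> v) (at_right 0)"
proof -
  have "((\<lambda>h::real. f (x + h *\<^sub>R v)) has_derivative (\<lambda>h. (h *\<^sub>R v) \<bullet> g)) (at 0)"
    by (rule has_derivative_compose[where f="\<lambda>h. x + h *\<^sub>R v"])
      (use assms in \<open>auto simp: gderiv_def intro!: derivative_eq_intros\<close>)
  then have "((\<lambda>h::real. f (x + h *\<^sub>R v)) has_field_derivative g \<bullet> v) (at 0)"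
    by (simp add: has_field_derivative_def inner_commute mult_commute_abs)
  then have "((\<lambda>h. (f (x + h *\<^sub>R v) - f x) / h) \<longlongrightarrow> g \<bullet> v) (at 0)"
    by (simp add: has_field_derivative_iff)
  then show ?thesis
    by (rule filterlim_mono) (auto simp: at_within_le_at)
qed

lemma proper_finite:
  assumes "proper F" "F x < \<infinity>"
  shows "F x = ereal (real_of_ereal (F x))"
  using assms by (cases "F x") (auto simp: proper_def)

lemma dom_grad_finite: "x \<in> dom_grad F \<Longrightarrow> F x < \<infinity>"
  using interior_subset[of "edom F"] by (auto simp: dom_grad_def edom_def)

lemma econvex_real:
  assumes "proper F" "econvex F" "F x < \<infinity>" "F y < \<infinity>" "0 \<le> t" "t \<le> 1"
  shows "F ((1 - t) *\<^sub>R x + t *\<^sub>R y) < \<infinity>"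
    and "real_of_ereal (F ((1 - t) *\<^sub>R x + t *\<^sub>R y)) \<le>
      (1 - t) * real_of_ereal (F x) + t * real_of_ereal (F y)"
proof -
  define a b where "a = real_of_ereal (F x)" and "b = real_of_ereal (F y)"
  have "F x = ereal a" "F y = ereal b"
    using assms by (auto simp: a_def b_def intro: proper_finite)
  moreover have "F ((1 - t) *\<^sub>R x + t *\<^sub>R y) \<le> ereal (1 - t) * F x + ereal t * F y"
    using assms unfolding econvex_def by auto
  ultimately have le: "F ((1 - t) *\<^sub>R x + t *\<^sub>R y) \<le> ereal ((1 - t) * a + t * b)"
    by simp
  then show fin: "F ((1 - t) *\<^sub>R x + t *\<^sub>R y) < \<infinity>"
    by (rule order.strict_trans1) simp
  show "real_of_ereal (F ((1 - t) *\<^sub>R x + t *\<^sub>R y)) \<le>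
      (1 - t) * real_of_ereal (F x) + t * real_of_ereal (F y)"
    using le proper_finite[OF assms(1) fin] unfolding a_def b_def
    by (metis ereal_less_eq(3))
qed

text \<open>Convexity bounds each difference quotient towards \<open>y\<close> by the one for the
  full step; letting the step tend to 0 turns the quotient into the gradient term.\<close>

lemma gradient_inequality:
  fixes F :: "'v::euclidean_space \<Rightarrow> ereal"
  assumes "proper F" "econvex F" "x \<in> dom_grad F" "F y < \<infinity>"
  shows "real_of_ereal (F x) + grad F x \<bullet> (y - x) \<le> real_of_ereal (F y)"
proof -
  let ?f = "\<lambda>y. real_of_ereal (F y)"
  have "((\<lambda>h. (?f (x + h *\<^sub>R (y - x)) - ?f x) / h) \<longlongrightarrow> grad F x \<bullet> (y - x)) (at_right 0)"
    by (intro gderiv_directional_limit dom_grad_gderiv assms)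
  moreover have "eventually (\<lambda>h. (?f (x + h *\<^sub>R (y - x)) - ?f x) / h \<le> ?f y - ?f x) (at_right 0)"
    using eventually_at_right_less[of 0] eventually_at_right_real[of 0 1, OF zero_less_one]
  proof eventually_elim
    case (elim h)
    have "?f ((1 - h) *\<^sub>R x + h *\<^sub>R y) \<le> (1 - h) * ?f x + h * ?f y"
      using elim by (intro econvex_real(2) assms dom_grad_finite[OF assms(3)]) auto
    moreover have "(1 - h) *\<^sub>R x + h *\<^sub>R y = x + h *\<^sub>R (y - x)"
      by (simp add: algebra_simps)
    ultimately show ?case
      using elim by (subst pos_divide_le_eq) (auto simp: algebra_simps)
  qed
  ultimately have "grad F x \<bullet> (y - x) \<le> ?f y - ?f x"
    by (rule tendsto_upperbound) simp
  then show ?thesis by simp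
qed

section \<open>Conjugates and their Bregman divergence\<close>

lemma conjugate_ge: "ereal (u \<bullet> x) - F x \<le> conjugate F u"
  unfolding conjugate_def by (rule SUP_upper) simp

text \<open>Equality in Fenchel-Young: by the gradient inequality the supremum is attained at
  \<open>q\<close>.\<close>

lemma conjugate_grad:
  fixes F :: "'v::euclidean_space \<Rightarrow> ereal"
  assumes "proper F" "econvex F" "q \<in> dom_grad F"
  shows "conjugate F (grad F q) = ereal (grad F q \<bullet> q - real_of_ereal (F q))"
proof (rule antisym)
  note fin = proper_finite[OF assms(1) dom_grad_finite[OF assms(3)]]
  show "conjugate F (grad F q) \<le> ereal (grad F q \<bullet> q - real_of_ereal (F q))"
    unfolding conjugate_def
  proof (rule SUP_least)
    fix x
    show "ereal (grad F q \<bullet> x) - F x \<le> ereal (grad F q \<bullet> q - real_of_ereal (F q))"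
    proof (cases "F x < \<infinity>")
      case True
      have "ereal (grad F q \<bullet> x) - F x = ereal (grad F q \<bullet> x - real_of_ereal (F x))"
        by (subst proper_finite[OF assms(1) True]) simp
      also have "\<dots> \<le> ereal (grad F q \<bullet> q - real_of_ereal (F q))"
        using gradient_inequality[OF assms True] by (simp add: algebra_simps)
      finally show ?thesis .
    qed auto
  qed
  show "ereal (grad F q \<bullet> q - real_of_ereal (F q)) \<le> conjugate F (grad F q)"
    using conjugate_ge[of "grad F q" q F] by (subst (asm) fin) simp
qed

text \<open>In other words, \<open>q\<close> is a subgradient of the conjugate at
  \<open>grad F q\<close>, seen by testing the supremum at \<open>q\<close>.\<close>

lemma conjugate_subgradient:
  fixes F :: "'v::euclidean_space \<Rightarrow> ereal"
  assumes "proper F" "econvex F" "q \<in> dom_grad F"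
  shows "conjugate F (grad F q) + ereal (q \<bullet> v) \<le> conjugate F (grad F q + v)"
proof -
  note fin = proper_finite[OF assms(1) dom_grad_finite[OF assms(3)]]
  have "conjugate F (grad F q) + ereal (q \<bullet> v) = ereal ((grad F q + v) \<bullet> q) - F q"
    by (subst fin) (simp add: conjugate_grad[OF assms] algebra_simps inner_commute)
  also have "\<dots> \<le> conjugate F (grad F q + v)" by (rule conjugate_ge)
  finally show ?thesis .
qed

text \<open>Supplies the existence of the limit in \<open>dir_deriv\<close>: difference quotients of
  a convex function are monotone in the step.\<close>

lemma tendsto_at_right_Inf_ereal:
  fixes Q :: "real \<Rightarrow> ereal"
  assumes mono: "\<And>h k. a < h \<Longrightarrow> h \<le> k \<Longrightarrow> Q h \<le> Q k"
  shows "(Q \<longlongrightarrow> (INF h\<in>{a<..}. Q h)) (at_right a)"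
proof (rule order_tendstoI)
  fix b assume b: "b < (INF h\<in>{a<..}. Q h)"
  show "eventually (\<lambda>h. b < Q h) (at_right a)"
    using eventually_at_right_less[of a]
  proof eventually_elim
    case (elim h)
    then have "(INF h\<in>{a<..}. Q h) \<le> Q h" by (intro INF_lower) simp
    with b show ?case by simp
  qed
next
  fix b assume "(INF h\<in>{a<..}. Q h) < b"
  then obtain k where k: "a < k" "Q k < b" by (auto simp: INF_less_iff)
  show "eventually (\<lambda>h. Q h < b) (at_right a)"
    using eventually_at_right_real[OF k(1)]
  proof eventually_elim
    case (elim h)
    then have "Q h \<le> Q k" by (intro mono) auto
    with k show ?case by simp
  qed
qed

lemma conjugate_not_MInfty:
  assumes "proper F"
  shows "conjugate F u \<noteq> -\<infinity>"
proof -
  obtain x where "F x < \<infinity>" using assms by (auto simp: proper_def edom_def)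
  then obtain r where "F x = ereal r" using proper_finite[OF assms] by blast
  then show ?thesis using conjugate_ge[of u x F] by auto
qed

text \<open>The conjugate is a supremum of affine functions, each of which lies below the chord. The
  slope form of the bound gives monotone difference quotients.\<close>

lemma conjugate_convex_line:
  fixes F :: "'v::real_inner \<Rightarrow> ereal"
  assumes "proper F" "conjugate F u = ereal c" "conjugate F (u + k *\<^sub>R v) = ereal s"
    and h: "0 < h" "h \<le> k"
  shows "conjugate F (u + h *\<^sub>R v) \<le> ereal (c + h * ((s - c) / k))"
  unfolding conjugate_def[of F "u + h *\<^sub>R v"]
proof (rule SUP_least)
  fix x
  show "ereal ((u + h *\<^sub>R v) \<bullet> x) - F x \<le> ereal (c + h * ((s - c) / k))"
  proof (cases "F x < \<infinity>")
    case True
    then obtain r where r: "F x = ereal r" using proper_finite[OF assms(1)] by blast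
    have "u \<bullet> x - r \<le> c" "(u + k *\<^sub>R v) \<bullet> x - r \<le> s"
      using conjugate_ge[of u x F] conjugate_ge[of "u + k *\<^sub>R v" x F] assms(2,3) r by auto
    then have "(1 - h / k) * (u \<bullet> x - r) + (h / k) * ((u + k *\<^sub>R v) \<bullet> x - r) \<le> (1 - h / k) * c + (h / k) * s"
      using h by (intro add_mono mult_left_mono) auto
    moreover have "(1 - h / k) * (u \<bullet> x - r) + (h / k) * ((u + k *\<^sub>R v) \<bullet> x - r) = (u + h *\<^sub>R v) \<bullet> x - r"
      using h by (simp add: inner_left_distrib) (simp add: field_simps)
    moreover have "(1 - h / k) * c + (h / k) * s = c + h * ((s - c) / k)"
      using h by (simp add: field_simps)
    ultimately show ?thesis by (simp add: r)
  qed auto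
qed

text \<open>The quotients decrease with the step to their infimum, and the subgradient
  \<open>q\<close> bounds each of them from below.\<close>

lemma dir_deriv_conjugate_ge:
  fixes F :: "'v::euclidean_space \<Rightarrow> ereal"
  assumes "proper F" "econvex F" "q \<in> dom_grad F"
  shows "ereal (q \<bullet> v) \<le> dir_deriv (conjugate F) (grad F q) v"
proof -
  let ?u = "grad F q"
  define Q where "Q h = (conjugate F (?u + h *\<^sub>R v) - conjugate F ?u) / ereal h" for h
  define c where "c = ?u \<bullet> q - real_of_ereal (F q)"
  have c: "conjugate F ?u = ereal c"
    by (simp add: conjugate_grad[OF assms] c_def)
  have ge: "ereal (q \<bullet> v) \<le> Q h" if "0 < h" for h
  proof -
    have "ereal (c + h * (q \<bullet> v)) \<le> conjugate F (?u + h *\<^sub>R v)"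
      using conjugate_subgradient[OF assms, of "h *\<^sub>R v"] c by simp
    then show ?thesis
      using that by (cases "conjugate F (?u + h *\<^sub>R v)") (auto simp: Q_def c field_simps)
  qed
  have "Q h \<le> Q k" if "0 < h" "h \<le> k" for h k
  proof (cases "conjugate F (?u + k *\<^sub>R v)")
    case (real s)
    have "conjugate F (?u + h *\<^sub>R v) \<le> ereal (c + h * ((s - c) / k))"
      using conjugate_convex_line[OF assms(1) c real that] .
    then show ?thesis
      using that conjugate_not_MInfty[OF assms(1)] unfolding Q_def real c
      by (cases "conjugate F (?u + h *\<^sub>R v)") (auto simp: field_simps)
  next
    case PInf
    then show ?thesis using that by (simp add: Q_def c)
  next
    case MInf
    then show ?thesis using conjugate_not_MInfty[OF assms(1)] by blast
  qed
  then have "(Q \<longlongrightarrow> (INF h\<in>{0<..}. Q h)) (at_right 0)"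
    by (rule tendsto_at_right_Inf_ereal)
  then have "dir_deriv (conjugate F) ?u v = (INF h\<in>{0<..}. Q h)"
    unfolding dir_deriv_def Q_def by (intro tendsto_Lim) auto
  moreover have "ereal (q \<bullet> v) \<le> (INF h\<in>{0<..}. Q h)"
    using ge by (intro INF_greatest) auto
  ultimately show ?thesis by simp
qed

lemma grad_conjugate_ge:
  fixes F :: "'v::euclidean_space \<Rightarrow> ereal"
  assumes "proper F" "econvex F" "q \<in> dom_grad F" and dom: "grad F q \<in> dom_grad (conjugate F)"
  shows "q \<bullet> v \<le> grad (conjugate F) (grad F q) \<bullet> v"
proof -
  let ?u = "grad F q" and ?f = "\<lambda>y. real_of_ereal (conjugate F y)"
  obtain c where c: "conjugate F ?u = ereal c"
    using conjugate_grad[OF assms(1-3)] by blast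
  have lim: "((\<lambda>h. (?f (?u + h *\<^sub>R v) - ?f ?u) / h) \<longlongrightarrow> grad (conjugate F) ?u \<bullet> v) (at_right 0)"
    by (intro gderiv_directional_limit dom_grad_gderiv dom)
  \<comment> \<open>Small steps stay in the interior of the domain. This matters because
    \<open>real_of_ereal\<close> would turn an infinite value into 0.\<close>
  have "((\<lambda>h. ?u + h *\<^sub>R v) \<longlongrightarrow> ?u + 0 *\<^sub>R v) (at_right 0)"
    by (intro tendsto_intros)
  then have "eventually (\<lambda>h. ?u + h *\<^sub>R v \<in> interior (edom (conjugate F))) (at_right 0)"
    using dom by (intro topological_tendstoD[where l="?u + 0 *\<^sub>R v"]) (auto simp: dom_grad_def)
  then have "eventually (\<lambda>h. q \<bullet> v \<le> (?f (?u + h *\<^sub>R v) - ?f ?u) / h) (at_right 0)"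
    using eventually_at_right_less[of 0]
  proof eventually_elim
    case (elim h)
    have "conjugate F (?u + h *\<^sub>R v) < \<infinity>"
      using elim(1) interior_subset[of "edom (conjugate F)"] by (auto simp: edom_def)
    then have "?f ?u + h * (q \<bullet> v) \<le> ?f (?u + h *\<^sub>R v)"
      using conjugate_subgradient[OF assms(1-3), of "h *\<^sub>R v"] c
      by (cases "conjugate F (?u + h *\<^sub>R v)") auto
    then show ?case
      using elim by (subst pos_le_divide_eq) (auto simp: mult.commute)
  qed
  then show ?thesis
    by (rule tendsto_lowerbound[OF lim]) simp
qed

text \<open>In both branches of \<open>bregman\<close> the subtracted linear term is at least the
  one given by the subgradient \<open>q\<close>, so no differentiability of the conjugate has to be
  established.\<close>

lemma bregman_conjugate_le:
  fixes F :: "'v::euclidean_space \<Rightarrow> ereal"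
  assumes "proper F" "econvex F" "q \<in> dom_grad F"
  shows "bregman (conjugate F) u (grad F q) \<le>
    conjugate F u - conjugate F (grad F q) - ereal (q \<bullet> (u - grad F q))"
  unfolding bregman_def using assms
  by (intro ereal_minus_mono order.refl) (auto intro: grad_conjugate_ge dir_deriv_conjugate_ge)

section \<open>A uniform gradient bound after shrinking towards an interior point\<close>

text \<open>Shrinking \<open>m\<close> towards \<open>q\<close> carries along a copy, scaled by
  \<open>e\<close>, of a ball around \<open>q\<close> on which \<open>F\<close> is bounded. On the
  copy, convexity bounds \<open>F\<close> from above uniformly in \<open>m\<close>, and a convex
  function with such room around a point has a bounded gradient there.\<close>

lemma interior_segment_gradient_bound:
  fixes F :: "'v::euclidean_space \<Rightarrow> ereal"
  assumes F: "proper F" "econvex F" "interior (edom F) \<subseteq> dom_grad F"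
    and D: "convex D" "D \<subseteq> edom F" "\<And>x. x \<in> D \<Longrightarrow> \<bar>real_of_ereal (F x)\<bar> \<le> B"
    and q: "q \<in> D" "q \<in> interior (edom F)"
    and e: "0 < e" "e < 1"
  obtains R where "\<And>m. m \<in> D \<Longrightarrow> (1 - e) *\<^sub>R m + e *\<^sub>R q \<in> dom_grad F"
    and "\<And>m. m \<in> D \<Longrightarrow> norm (grad F ((1 - e) *\<^sub>R m + e *\<^sub>R q)) \<le> R"
proof -
  let ?f = "\<lambda>y. real_of_ereal (F y)"
  obtain r where r: "0 < r" "cball q r \<subseteq> interior (edom F)"
    using q(2) open_contains_cball[of "interior (edom F)"] by auto
  have "continuous_on (cball q r) ?f"
    using r F(3) by (intro continuous_at_imp_continuous_on ballI differentiable_imp_continuous_within)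
      (auto simp: dom_grad_def)
  then have "compact (?f ` cball q r)"
    by (intro compact_continuous_image) auto
  then have "bounded (?f ` cball q r)"
    by (rule compact_imp_bounded)
  then obtain M where M: "\<And>x. x \<in> cball q r \<Longrightarrow> \<bar>?f x\<bar> \<le> M"
    unfolding bounded_iff real_norm_def by blast
  have ball: "F x < \<infinity>" if "x \<in> cball q r" for x
    using that r interior_subset[of "edom F"] by (auto simp: edom_def)
  have fin: "F m < \<infinity>" if "m \<in> D" for m
    using D(2) that by (auto simp: edom_def)
  have dom: "(1 - e) *\<^sub>R m + e *\<^sub>R q \<in> dom_grad F" if m: "m \<in> D" for m
  proof -
    let ?y = "(1 - e) *\<^sub>R m + e *\<^sub>R q"
    \<comment> \<open>Any \<open>w\<close> in this ball is the combination of \<open>m\<close> and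
      the point \<open>q + (w - y) / e\<close> of the ball around \<open>q\<close>.\<close>
    have "ball ?y (e * r) \<subseteq> edom F"
    proof
      fix w assume w: "w \<in> ball ?y (e * r)"
      have "norm ((1 / e) *\<^sub>R (w - ?y)) = norm (?y - w) / e"
        unfolding norm_scaleR norm_minus_commute[of w] using e by simp
      also have "\<dots> \<le> r"
        using w e by (simp add: pos_divide_le_eq dist_norm mult.commute[of e])
      finally have "norm ((1 / e) *\<^sub>R (w - ?y)) \<le> r" .
      then have "q + (1 / e) *\<^sub>R (w - ?y) \<in> cball q r"
        by (simp add: dist_norm)
      then have "F ((1 - e) *\<^sub>R m + e *\<^sub>R (q + (1 / e) *\<^sub>R (w - ?y))) < \<infinity>"
        using e fin[OF m] by (intro econvex_real(1)[OF F(1,2) _ ball]) auto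
      moreover have "(1 - e) *\<^sub>R m + e *\<^sub>R (q + (1 / e) *\<^sub>R (w - ?y)) = w"
        using e by (simp add: scaleR_add_right)
      ultimately show "w \<in> edom F" by (simp add: edom_def)
    qed
    then have "?y \<in> interior (edom F)"
      using e r by (intro interiorI[of "ball ?y (e * r)"]) auto
    then show ?thesis using F(3) by blast
  qed
  have "norm (grad F ((1 - e) *\<^sub>R m + e *\<^sub>R q)) \<le> (2 * B + M) / (e * r)" if m: "m \<in> D" for m
  proof -
    define y where "y = (1 - e) *\<^sub>R m + e *\<^sub>R q"
    define g where "g = grad F y"
    \<comment> \<open>The gradient is tested in its own direction, at the largest length keeping
      \<open>q + v\<close> in the ball. For \<open>g = 0\<close> division by zero gives
      \<open>v = 0\<close>, and the computation remains valid.\<close>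
    define v where "v = (r / norm g) *\<^sub>R g"
    have "norm v \<le> r" using r by (simp add: v_def)
    then have v: "q + v \<in> cball q r" by (simp add: dist_norm)
    have "y \<in> D"
      using convexD_alt[OF D(1) m q(1)] e by (simp add: y_def)
    have eq: "y + e *\<^sub>R v = (1 - e) *\<^sub>R m + e *\<^sub>R (q + v)"
      by (simp add: y_def scaleR_add_right)
    have "F (y + e *\<^sub>R v) < \<infinity>"
      unfolding eq using e fin[OF m] v by (intro econvex_real(1)[OF F(1,2) _ ball]) auto
    then have "?f y + g \<bullet> (e *\<^sub>R v) \<le> ?f (y + e *\<^sub>R v)"
      using gradient_inequality[OF F(1,2) dom[OF m, folded y_def]] by (force simp: g_def)
    also have "\<dots> \<le> (1 - e) * ?f m + e * ?f (q + v)"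
      unfolding eq using e fin[OF m] v by (intro econvex_real(2)[OF F(1,2) _ ball]) auto
    also have "\<dots> \<le> 1 * B + 1 * M"
      using e D(3)[OF m] M[OF v] abs_ge_zero[of "?f m"] abs_ge_zero[of "?f (q + v)"]
      by (intro add_mono order.trans[OF mult_left_mono[of _ B] mult_right_mono]
          order.trans[OF mult_left_mono[of _ M] mult_right_mono]) linarith+
    finally have "g \<bullet> (e *\<^sub>R v) \<le> 2 * B + M"
      using D(3)[OF \<open>y \<in> D\<close>] by linarith
    moreover have "g \<bullet> (e *\<^sub>R v) = norm g * (e * r)"
      by (simp add: v_def dot_square_norm power2_eq_square)
    ultimately show ?thesis
      using e r by (subst pos_le_divide_eq) (auto simp: g_def y_def mult_ac)
  qed
  with dom show ?thesis using that by blast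
qed

section \<open>Finitely supported laws\<close>

lemma pmf_of_weights:
  fixes w :: "'i \<Rightarrow> real"
  assumes "finite S" "\<And>i. i \<in> S \<Longrightarrow> 0 \<le> w i" "sum w S = 1"
  obtains N where "\<And>i. pmf N i = (if i \<in> S then w i else 0)"
proof -
  let ?w = "\<lambda>i. if i \<in> S then w i else 0"
  have "(\<integral>\<^sup>+i. ennreal (?w i) \<partial>count_space UNIV) = (\<Sum>i\<in>S. ennreal (?w i))"
    using assms by (intro nn_integral_count_space') auto
  also have "\<dots> = ennreal (\<Sum>i\<in>S. ?w i)"
    using assms by (intro sum_ennreal) auto
  also have "(\<Sum>i\<in>S. ?w i) = 1"
    using assms by simp
  finally have "pmf (embed_pmf ?w) i = ?w i" for i
    using assms by (intro pmf_embed_pmf) auto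
  then show ?thesis using that by blast
qed

lemma finite_measure_pmf_Int:
  assumes "finite (set_pmf M)"
  shows "measure_pmf.prob M S = (\<Sum>x\<in>set_pmf M \<inter> S. pmf M x)"
  using assms by (metis Int_commute finite_Int measure_Int_set_pmf measure_measure_pmf_finite)

lemma expectation_finite:
  fixes Y :: "'a \<Rightarrow> 'b::{banach, second_countable_topology}"
  assumes "finite (set_pmf M)"
  shows "measure_pmf.expectation M Y = (\<Sum>x\<in>set_pmf M. pmf M x *\<^sub>R Y x)"
  using assms by (intro integral_measure_pmf) auto

lemma expectation_in_convex:
  fixes Y :: "'a \<Rightarrow> 'b::{banach, second_countable_topology}"
  assumes "finite (set_pmf M)" "convex C" "\<And>x. x \<in> set_pmf M \<Longrightarrow> Y x \<in> C"
  shows "measure_pmf.expectation M Y \<in> C"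
  unfolding expectation_finite[OF assms(1)] using assms
  by (intro convex_sum) (auto simp: sum_pmf_eq_1)

section \<open>Conditioning on finite supports\<close>

lemma expectation_cond_pmf:
  fixes Y :: "'a \<Rightarrow> 'b::{banach, second_countable_topology}"
  assumes fin: "finite (set_pmf M)" and ne: "set_pmf M \<inter> S \<noteq> {}"
  shows "measure_pmf.prob M S *\<^sub>R measure_pmf.expectation (cond_pmf M S) Y =
    (\<Sum>x\<in>set_pmf M \<inter> S. pmf M x *\<^sub>R Y x)"
proof -
  have pos: "measure_pmf.prob M S \<noteq> 0"
    using ne by (meson Int_emptyI measure_pmf_zero_iff)
  have "measure_pmf.expectation (cond_pmf M S) Y =
      (\<Sum>x\<in>set_pmf M \<inter> S. (pmf M x / measure_pmf.prob M S) *\<^sub>R Y x)"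
    using fin ne by (auto simp: expectation_finite pmf_cond intro!: sum.cong)
  then show ?thesis
    using pos by (simp add: scaleR_sum_right)
qed

text \<open>The sum is grouped by the value of \<open>X\<close>: on each fibre
  \<open>v (X x)\<close> is constant and the conditional expectation is the fibre average of
  \<open>Y\<close>.\<close>

lemma tower_property:
  fixes Y :: "'a \<Rightarrow> 'b::{banach, second_countable_topology, real_inner}"
  assumes fin: "finite (set_pmf M)"
  shows "(\<Sum>x\<in>set_pmf M. pmf M x * (Y x \<bullet> v (X x))) =
    (\<Sum>x\<in>set_pmf M. pmf M x * (pmf_cond_exp M Y X x \<bullet> v (X x)))"
proof -
  have "(\<Sum>x\<in>{x\<in>set_pmf M. X x = k}. pmf M x * (Y x \<bullet> v (X x))) =
      (\<Sum>x\<in>{x\<in>set_pmf M. X x = k}. pmf M x * (pmf_cond_exp M Y X x \<bullet> v (X x)))"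
    if k: "k \<in> X ` set_pmf M" for k
  proof -
    let ?S = "{x. X x = k}"
    define e where "e = measure_pmf.expectation (cond_pmf M ?S) Y"
    have S: "{x\<in>set_pmf M. X x = k} = set_pmf M \<inter> ?S" by auto
    have "(\<Sum>x\<in>set_pmf M \<inter> ?S. pmf M x * (Y x \<bullet> v (X x))) =
        (\<Sum>x\<in>set_pmf M \<inter> ?S. pmf M x *\<^sub>R Y x) \<bullet> v k"
      by (auto simp: inner_sum_left intro: sum.cong)
    also have "\<dots> = measure_pmf.prob M ?S * (e \<bullet> v k)"
      using k by (subst expectation_cond_pmf[OF fin, symmetric]) (auto simp: e_def)
    also have "\<dots> = (\<Sum>x\<in>set_pmf M \<inter> ?S. pmf M x * (pmf_cond_exp M Y X x \<bullet> v (X x)))"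
      by (auto simp: finite_measure_pmf_Int[OF fin] sum_distrib_right pmf_cond_exp_def e_def
          intro!: sum.cong)
    finally show ?thesis unfolding S .
  qed
  then show ?thesis
    by (subst (1 2) sum.image_gen[OF fin, of _ X]) (rule sum.cong, auto)
qed

text \<open>Since \<open>a\<close> is itself observed, the conditioning event is a product
  \<open>?S \<times> {a}\<close>; by independence only the condition on the first component matters
  for \<open>Y\<close>.\<close>

lemma pmf_cond_exp_pair:
  fixes Y :: "'a \<Rightarrow> 'c::{banach, second_countable_topology}"
  assumes w: "w \<in> set_pmf M" "a \<in> set_pmf p"
  shows "pmf_cond_exp (pair_pmf M p) (\<lambda>(w, a). Y w) (\<lambda>(w, a). (X a w, a)) (w, a) =
    pmf_cond_exp M Y (X a) w"
proof -
  let ?S = "{w'. X a w' = X a w}"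
  have S: "{w'. (case w' of (w, a) \<Rightarrow> (X a w, a)) = (case (w, a) of (w, a) \<Rightarrow> (X a w, a))} = ?S \<times> {a}"
    by auto
  have ne: "set_pmf M \<inter> ?S \<noteq> {}" "set_pmf (pair_pmf M p) \<inter> (?S \<times> {a}) \<noteq> {}"
    using w by auto
  have prob: "measure_pmf.prob (pair_pmf M p) (?S \<times> {a}) = measure_pmf.prob M ?S * pmf p a"
  proof -
    \<comment> \<open>Intersecting with the support makes the first factor countable, as the product
      formula asks.\<close>
    have "measure_pmf.prob (pair_pmf M p) (?S \<times> {a}) = 
      measure_pmf.prob (pair_pmf M p) ((?S \<inter> set_pmf M) \<times> {a})"
      by (rule measure_prob_cong_0) (auto simp: pmf_pair set_pmf_iff)
    also have "\<dots> = measure_pmf.prob M (?S \<inter> set_pmf M) * measure_pmf.prob p {a}"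
      by (rule measure_pmf_prob_product) auto
    also have "\<dots> = measure_pmf.prob M ?S * pmf p a"
      by (simp add: measure_pmf_single measure_Int_set_pmf)
    finally show ?thesis .
  qed
  have "cond_pmf (pair_pmf M p) (?S \<times> {a}) = pair_pmf (cond_pmf M ?S) (return_pmf a)"
  proof (rule pmf_eqI)
    fix i :: "'a \<times> 'b"
    show "pmf (cond_pmf (pair_pmf M p) (?S \<times> {a})) i = pmf (pair_pmf (cond_pmf M ?S) (return_pmf a)) i"
      using w by (cases i) (simp add: pmf_cond[OF ne(2)] pmf_cond[OF ne(1)] pmf_pair prob set_pmf_iff)
  qed
  then show ?thesis
    unfolding pmf_cond_exp_def S by (simp add: case_prod_unfold)
qed

lemma expectation_pair_finite:
  fixes f :: "'a \<Rightarrow> 'b \<Rightarrow> real"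
  assumes "finite (set_pmf M)" "finite (set_pmf p)"
  shows "measure_pmf.expectation (pair_pmf M p) (\<lambda>(w, a). f w a) =
    (\<Sum>a\<in>set_pmf p. pmf p a * (\<Sum>w\<in>set_pmf M. pmf M w * f w a))"
proof -
  have "measure_pmf.expectation (pair_pmf M p) (\<lambda>(w, a). f w a) =
      (\<Sum>w\<in>set_pmf M. \<Sum>a\<in>set_pmf p. pmf M w * pmf p a * f w a)"
    using assms by (subst expectation_finite)
      (auto simp: sum.cartesian_product pmf_pair intro!: sum.cong)
  also have "\<dots> = (\<Sum>a\<in>set_pmf p. \<Sum>w\<in>set_pmf M. pmf M w * pmf p a * f w a)"
    by (rule sum.swap)
  finally show ?thesis
    by (simp add: sum_distrib_left mult_ac)
qed

text \<open>Turns the integral in \<open>expected_gain\<close> into a finite real sum; nonnegativity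
  makes the truncation by \<open>e2ennreal\<close> lossless.\<close>

lemma nn_integral_pair_finite:
  assumes fin: "finite (set_pmf M)" "finite (set_pmf p)"
    and h: "\<And>w a. w \<in> set_pmf M \<Longrightarrow> a \<in> set_pmf p \<Longrightarrow> h (w, a) = ereal (r w a)"
    and nonneg: "\<And>w a. w \<in> set_pmf M \<Longrightarrow> a \<in> set_pmf p \<Longrightarrow> 0 \<le> r w a"
  shows "enn2ereal (\<integral>\<^sup>+x. e2ennreal (h x) \<partial>measure_pmf (pair_pmf M p)) =
    ereal (\<Sum>a\<in>set_pmf p. pmf p a * (\<Sum>w\<in>set_pmf M. pmf M w * r w a))"
proof -
  have "(\<integral>\<^sup>+x. e2ennreal (h x) \<partial>measure_pmf (pair_pmf M p)) =
      (\<Sum>x\<in>set_pmf (pair_pmf M p). e2ennreal (h x) * ennreal (pmf (pair_pmf M p) x))"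
    using fin by (intro nn_integral_measure_pmf_finite) auto
  also have "\<dots> = (\<Sum>x\<in>set_pmf (pair_pmf M p). ennreal (case x of (w, a) \<Rightarrow> r w a * pmf (pair_pmf M p) x))"
    using h nonneg by (intro sum.cong) (auto simp: ennreal_mult' e2ennreal_ereal)
  also have "\<dots> = ennreal (\<Sum>x\<in>set_pmf (pair_pmf M p). case x of (w, a) \<Rightarrow> r w a * pmf (pair_pmf M p) x)"
    using nonneg by (intro sum_ennreal) auto
  also have "(\<Sum>x\<in>set_pmf (pair_pmf M p). case x of (w, a) \<Rightarrow> r w a * pmf (pair_pmf M p) x) =
      measure_pmf.expectation (pair_pmf M p) (\<lambda>(w, a). r w a)"
    using fin by (subst expectation_finite) (auto intro!: sum.cong)
  also have "\<dots> = (\<Sum>a\<in>set_pmf p. pmf p a * (\<Sum>w\<in>set_pmf M. pmf M w * r w a))"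
    using fin by (rule expectation_pair_finite)
  finally show ?thesis
    using nonneg by (simp add: enn2ereal_ennreal sum_nonneg)
qed

lemma sum_map_pmf_finite:
  fixes h :: "'b \<Rightarrow> real"
  assumes "finite (set_pmf M)"
  shows "(\<Sum>x\<in>set_pmf (map_pmf T M). pmf (map_pmf T M) x * h x) = (\<Sum>x\<in>set_pmf M. pmf M x * h (T x))"
  using expectation_finite[of "map_pmf T M" h] expectation_finite[of M "\<lambda>x. h (T x)"] assms
  by simp

section \<open>The information ratio bound\<close>

text \<open>Young's inequality with exponents \<open>s = 1 / lam\<close> and \<open>1 - s\<close>
  for the factors \<open>G / r\<close> and \<open>\<beta> * r powr k\<close>. The scale
  \<open>r = \<eta> / lam\<close> makes the first summand \<open>G / \<eta>\<close>, and
  \<open>k = 1 / (lam - 1)\<close> makes the powers of \<open>r\<close> cancel in the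
  product.\<close>

lemma information_ratio_young:
  fixes \<beta> lam \<eta> G :: real
  assumes "0 \<le> \<beta>" "1 < lam" "0 < \<eta>" "0 \<le> G"
  shows "\<beta> powr (1 - 1 / lam) * G powr (1 / lam) \<le>
    G / \<eta> + \<beta> * (1 - 1 / lam) * (\<eta> / lam) powr (1 / (lam - 1))"
proof (cases "\<beta> = 0 \<or> G = 0")
  case True
  then show ?thesis using assms by auto
next
  case False
  define s where "s = 1 / lam"
  define r where "r = \<eta> / lam"
  have s: "0 < s" "s < 1" "0 < r" and pos: "0 < \<beta>" "0 < G"
    using assms False by (auto simp: s_def r_def)
  define k where "k = 1 / (lam - 1)"
  have k: "k * (1 - s) = s"
    using assms by (simp add: k_def s_def field_simps)
  have "(G / r) powr s * (\<beta> * r powr k) powr (1 - s) \<le> s * (G / r) + (1 - s) * (\<beta> * r powr k)"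
    using s pos by (intro Youngs_inequality_0) auto
  also have "(G / r) powr s * (\<beta> * r powr k) powr (1 - s) = \<beta> powr (1 - s) * G powr s"
    using s pos by (simp add: powr_mult powr_divide powr_powr k)
  also have "s * (G / r) = G / \<eta>"
    using assms by (simp add: s_def r_def)
  finally show ?thesis
    by (simp add: s_def r_def k_def mult_ac)
qed

context linear_pm_game
begin

abbreviation "Fr \<equiv> \<lambda>x. real_of_ereal (F x)"

lemma F_proper: "proper F" and F_convex: "econvex F"
  and F_smooth: "interior (edom F) \<subseteq> dom_grad F"
  using legendre_F by (auto simp: legendre_def essentially_smooth_def)

lemma F_finite_D: "x \<in> D \<Longrightarrow> F x < \<infinity>"
  using D_dom by (auto simp: edom_def)

text \<open>The finite diameter bounds differences of values, and \<open>F\<close> is finite at some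
  point of the nonempty set \<open>D\<close>.\<close>

lemma F_bounded_D:
  obtains B where "\<And>x. x \<in> D \<Longrightarrow> \<bar>Fr x\<bar> \<le> B"
proof -
  obtain q where q: "q \<in> D"
    using rel_interior_D rel_interior_subset[of D] by blast
  define s where "s = (SUP x\<in>D. SUP y\<in>D. F x - F y)"
  have real: "F x = ereal (Fr x)" if "x \<in> D" for x
    by (rule proper_finite[OF F_proper F_finite_D[OF that]])
  have le: "ereal (Fr x - Fr y) \<le> s" if "x \<in> D" "y \<in> D" for x y
  proof -
    have "F x - F y \<le> (SUP y\<in>D. F x - F y)"
      using that(2) by (rule SUP_upper)
    also have "\<dots> \<le> s"
      unfolding s_def using that(1) by (rule SUP_upper)
    finally have "F x - F y \<le> s" .
    then show ?thesis
      by (subst (asm) (1 2) real) (use that in simp_all)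
  qed
  have "s < \<infinity>" "0 \<le> s"
    using diam_finite le[OF q q] by (auto simp: s_def zero_ereal_def)
  then obtain r where r: "s = ereal r" by (cases s) auto
  have "\<bar>Fr x\<bar> \<le> \<bar>Fr q\<bar> + r" if "x \<in> D" for x
    using le[OF that q] le[OF q that] unfolding r ereal_less_eq by linarith
  then show ?thesis using that by blast
qed

lemma loss_D:
  assumes "x \<in> D" "z \<in> Z"
  shows "0 \<le> x \<bullet> loss z" "x \<bullet> loss z \<le> 1"
proof -
  have "convex {x. 0 \<le> x \<bullet> loss z \<and> x \<bullet> loss z \<le> 1}"
    by (auto simp: convex_alt inner_left_distrib intro: convex_bound_le)
  then have "convex hull A \<subseteq> {x. 0 \<le> x \<bullet> loss z \<and> x \<bullet> loss z \<le> 1}"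
    using inner_loss assms(2) by (intro hull_minimal) auto
  then show "0 \<le> x \<bullet> loss z" "x \<bullet> loss z \<le> 1"
    using assms(1) D_subset by auto
qed

lemma Prob_sum:
  assumes "p \<in> Prob"
  shows "(\<Sum>a\<in>set_pmf p. pmf p a * h a) = (\<Sum>a\<in>A. pmf p a * h a)"
  using assms finite_A by (intro sum.mono_neutral_left) (auto simp: Prob_def set_pmf_iff)

lemma expected_regret_sum:
  assumes "\<nu> \<in> V" "p \<in> Prob"
  shows "expected_regret \<nu> p =
    (\<Sum>a\<in>A. pmf p a * (\<Sum>w\<in>set_pmf \<nu>. pmf \<nu> w * ((a - snd w) \<bullet> loss (fst w))))"
proof -
  have fin: "finite (set_pmf \<nu>)" "finite (set_pmf p)"
    using assms finite_A by (auto simp: V_def Prob_def intro: finite_subset)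
  have eq: "(\<lambda>((z, a'), a). (a - a') \<bullet> loss z) = (\<lambda>(w, a). (a - snd w) \<bullet> loss (fst w))"
    by auto
  show ?thesis
    unfolding expected_regret_def eq expectation_pair_finite[OF fin] Prob_sum[OF assms(2)] ..
qed

text \<open>The action is independent of \<open>\<nu>\<close>, so the posterior mean after playing
  \<open>a\<close> is computed from \<open>\<nu>\<close> and the signal of \<open>a\<close> alone.
  The hypotheses on \<open>\<mu>\<close> and \<open>y\<close> make the divergence a finite real
  number.\<close>

lemma expected_gain_sum:
  fixes \<nu> :: "('z \<times> (real ^ 'n)) pmf"
  defines "\<mu> \<equiv> measure_pmf.expectation \<nu> snd"
    and "y \<equiv> \<lambda>a. pmf_cond_exp \<nu> snd (\<lambda>w. Phi a (fst w))"
  assumes "\<nu> \<in> V" "p \<in> Prob" and \<mu>: "\<mu> \<in> dom_grad F"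
    and y: "\<And>a w. w \<in> set_pmf \<nu> \<Longrightarrow> F (y a w) < \<infinity>"
  shows "expected_gain \<nu> p = ereal (\<Sum>a\<in>A. pmf p a * (\<Sum>w\<in>set_pmf \<nu>. pmf \<nu> w *
    (Fr (y a w) - Fr \<mu> - grad F \<mu> \<bullet> (y a w - \<mu>))))"
proof -
  have fin: "finite (set_pmf \<nu>)" "finite (set_pmf p)"
    using assms(3,4) finite_A by (auto simp: V_def Prob_def intro: finite_subset)
  have eq: "(\<lambda>((z, a'), a). a') = (\<lambda>(w, a). snd w)"
    "(\<lambda>((z, a'), a). (Phi a z, a)) = (\<lambda>(w, a). (Phi a (fst w), a))"
    by auto
  have mu: "measure_pmf.expectation (pair_pmf \<nu> p) (\<lambda>(w, a). snd w) = \<mu>"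
    by (simp add: case_prod_unfold \<mu>_def)
  have "bregman F (pmf_cond_exp (pair_pmf \<nu> p) (\<lambda>(w, a). snd w) (\<lambda>(w, a). (Phi a (fst w), a)) (w, a)) \<mu> =
      ereal (Fr (y a w) - Fr \<mu> - grad F \<mu> \<bullet> (y a w - \<mu>))"
    if wa: "w \<in> set_pmf \<nu>" "a \<in> set_pmf p" for w a
  proof -
    obtain s t where "F (y a w) = ereal s" "F \<mu> = ereal t"
      using proper_finite[OF F_proper] y[OF wa(1)] dom_grad_finite[OF \<mu>] by metis
    moreover have "pmf_cond_exp \<nu> snd (\<lambda>w. Phi a (fst w)) w = y a w"
      by (simp add: y_def)
    ultimately show ?thesis
      unfolding pmf_cond_exp_pair[OF wa] bregman_def by (simp add: \<mu>)
  qed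
  moreover have "0 \<le> Fr (y a w) - Fr \<mu> - grad F \<mu> \<bullet> (y a w - \<mu>)" if "w \<in> set_pmf \<nu>" for w a
    using gradient_inequality[OF F_proper F_convex \<mu> y[OF that]] by (simp add: algebra_simps)
  ultimately show ?thesis
    unfolding expected_gain_def Let_def eq mu Prob_sum[OF assms(4), symmetric]
    using fin by (intro nn_integral_pair_finite) auto
qed

section \<open>The information ratio for mixtures\<close>

text \<open>Young's inequality replaces the power of the gain by a linear term, and the divergence
  from the prior mean is replaced by the divergence from \<open>q\<close>, which is larger on
  average. The convex set \<open>C\<close> keeps the prior and posterior means where
  \<open>F\<close> is differentiable.\<close>

lemma information_ratio_linearised:
  fixes \<nu> :: "('z \<times> (real ^ 'n)) pmf"
  defines "y \<equiv> \<lambda>a. pmf_cond_exp \<nu> snd (\<lambda>w. Phi a (fst w))"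
  assumes ratio: "has_information_ratio \<alpha> \<beta> lam" and param: "0 \<le> \<beta>" "1 < lam" "0 < \<eta>"
    and \<nu>: "\<nu> \<in> V" and q: "q \<in> dom_grad F"
    and C: "convex C" "C \<subseteq> dom_grad F" "snd ` set_pmf \<nu> \<subseteq> C"
  obtains p where "p \<in> Prob"
    and "(\<Sum>a\<in>A. pmf p a * (\<Sum>w\<in>set_pmf \<nu>. pmf \<nu> w *
      ((a - snd w) \<bullet> loss (fst w) - (Fr (y a w) - Fr q - grad F q \<bullet> (y a w - q)) / \<eta>))) \<le>
      \<alpha> + \<beta> * (1 - 1 / lam) * (\<eta> / lam) powr (1 / (lam - 1))"
proof -
  obtain p where p: "p \<in> Prob" and le: "ereal (expected_regret \<nu> p) \<le>
      ereal \<alpha> + ereal (\<beta> powr (1 - 1 / lam)) * ereal_powr (expected_gain \<nu> p) (1 / lam)"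
    using ratio \<nu> param unfolding has_information_ratio_def by auto
  define \<mu> where "\<mu> = measure_pmf.expectation \<nu> snd"
  have fin: "finite (set_pmf \<nu>)"
    using \<nu> by (simp add: V_def)
  have one: "(\<Sum>w\<in>set_pmf \<nu>. pmf \<nu> w) = 1"
    using fin by (simp add: sum_pmf_eq_1)
  have "\<mu> \<in> C"
    unfolding \<mu>_def using fin C by (intro expectation_in_convex) auto
  have yC: "y a w \<in> C" if "w \<in> set_pmf \<nu>" for a w
  proof -
    have "set_pmf \<nu> \<inter> {w'. Phi a (fst w') = Phi a (fst w)} \<noteq> {}"
      using that by auto
    then show ?thesis
      unfolding y_def pmf_cond_exp_def using fin C
      by (intro expectation_in_convex) auto
  qed
  have y_fin: "F (y a w) < \<infinity>" if "w \<in> set_pmf \<nu>" for a w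
    using C(2) yC[OF that] by (intro dom_grad_finite) blast
  have dom: "\<mu> \<in> dom_grad F"
    using \<open>\<mu> \<in> C\<close> C by auto
  define r where "r a w = Fr (y a w) - Fr \<mu> - grad F \<mu> \<bullet> (y a w - \<mu>)" for a w
  define d where "d a w = Fr (y a w) - Fr q - grad F q \<bullet> (y a w - q)" for a w
  define G where "G = (\<Sum>a\<in>A. pmf p a * (\<Sum>w\<in>set_pmf \<nu>. pmf \<nu> w * r a w))"
  have gain: "expected_gain \<nu> p = ereal G"
    unfolding G_def r_def y_def \<mu>_def
    by (rule expected_gain_sum) (use \<nu> p dom y_fin in \<open>auto simp: y_def \<mu>_def\<close>)
  have "0 \<le> r a w" if "w \<in> set_pmf \<nu>" for a w
    using gradient_inequality[OF F_proper F_convex dom y_fin[OF that]] by (simp add: r_def algebra_simps)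
  then have "0 \<le> G"
    by (auto simp: G_def intro!: sum_nonneg mult_nonneg_nonneg)
  have mean: "(\<Sum>w\<in>set_pmf \<nu>. pmf \<nu> w * (y a w \<bullet> c)) = \<mu> \<bullet> c" for a c
    using tower_property[OF fin, of snd "\<lambda>_. c" "\<lambda>w. Phi a (fst w)"]
    by (simp add: y_def \<mu>_def expectation_finite[OF fin] inner_sum_left)
  \<comment> \<open>The posterior means average to \<open>\<mu>\<close>, so the two expected
    divergences differ exactly by the divergence of \<open>\<mu>\<close> from \<open>q\<close>,
    which is nonnegative.\<close>
  have rd: "(\<Sum>w\<in>set_pmf \<nu>. pmf \<nu> w * r a w) \<le> (\<Sum>w\<in>set_pmf \<nu>. pmf \<nu> w * d a w)" for a
  proof -
    have "(\<Sum>w\<in>set_pmf \<nu>. pmf \<nu> w * d a w) - (\<Sum>w\<in>set_pmf \<nu>. pmf \<nu> w * r a w) =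
        (\<Sum>w\<in>set_pmf \<nu>. pmf \<nu> w * (y a w \<bullet> (grad F \<mu> - grad F q)) +
          pmf \<nu> w * (Fr \<mu> - grad F \<mu> \<bullet> \<mu> - Fr q + grad F q \<bullet> q))"
      unfolding sum_subtractf[symmetric]
      by (intro sum.cong) (auto simp: d_def r_def algebra_simps inner_commute)
    also have "\<dots> = \<mu> \<bullet> (grad F \<mu> - grad F q) + (Fr \<mu> - grad F \<mu> \<bullet> \<mu> - Fr q + grad F q \<bullet> q)"
      unfolding sum.distrib mean sum_distrib_right[symmetric] one by simp
    also have "\<dots> = Fr \<mu> - (Fr q + grad F q \<bullet> (\<mu> - q))"
      by (simp add: algebra_simps inner_commute)
    also have "\<dots> \<ge> 0"
      using gradient_inequality[OF F_proper F_convex q dom_grad_finite[OF dom]] by simp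
    finally show ?thesis by simp
  qed
  have G_le: "G \<le> (\<Sum>a\<in>A. pmf p a * (\<Sum>w\<in>set_pmf \<nu>. pmf \<nu> w * d a w))"
    unfolding G_def by (rule sum_mono, rule mult_left_mono[OF rd]) simp
  have "expected_regret \<nu> p \<le> \<alpha> + \<beta> powr (1 - 1 / lam) * G powr (1 / lam)"
    using le by (simp add: gain ereal_powr_def)
  also have "\<dots> \<le> \<alpha> + (G / \<eta> + \<beta> * (1 - 1 / lam) * (\<eta> / lam) powr (1 / (lam - 1)))"
    using information_ratio_young[OF param \<open>0 \<le> G\<close>] by simp
  finally have "expected_regret \<nu> p - G / \<eta> \<le> \<alpha> + \<beta> * (1 - 1 / lam) * (\<eta> / lam) powr (1 / (lam - 1))"
    by simp
  moreover have "(\<Sum>a\<in>A. pmf p a * (\<Sum>w\<in>set_pmf \<nu>. pmf \<nu> w * ((a - snd w) \<bullet> loss (fst w) - d a w / \<eta>))) =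
      expected_regret \<nu> p - (\<Sum>a\<in>A. pmf p a * (\<Sum>w\<in>set_pmf \<nu>. pmf \<nu> w * d a w)) / \<eta>"
    unfolding expected_regret_sum[OF \<nu> p]
    by (simp add: right_diff_distrib sum_subtractf sum_divide_distrib sum_distrib_left)
  moreover have "G / \<eta> \<le> (\<Sum>a\<in>A. pmf p a * (\<Sum>w\<in>set_pmf \<nu>. pmf \<nu> w * d a w)) / \<eta>"
    using G_le param by (simp add: divide_right_mono)
  ultimately show ?thesis
    using that[OF p] unfolding d_def by linarith
qed

text \<open>The terms \<open>grad F y \<bullet> y - Fr y\<close> and
  \<open>grad F q \<bullet> q - Fr q\<close> are the values of the conjugate at
  \<open>grad F y\<close> and \<open>grad F q\<close>: the summand is the objective for the
  estimator \<open>P a * (grad F q - grad F y) / \<eta>\<close>. The mixture is taken over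
  \<open>\<nu>\<close> itself, while \<open>y\<close> comes from the law pushed towards
  \<open>q\<close>.\<close>

lemma finite_mixture_bound:
  assumes ratio: "has_information_ratio \<alpha> \<beta> lam" and param: "0 \<le> \<beta>" "1 < lam" "0 < \<eta>"
    and \<nu>: "\<nu> \<in> V" and q: "q \<in> D" "q \<in> dom_grad F" and e: "0 < e" "e < 1"
  defines "c \<equiv> \<alpha> + \<beta> * (1 - 1 / lam) * (\<eta> / lam) powr (1 / (lam - 1))"
    and "D' \<equiv> (\<lambda>m. (1 - e) *\<^sub>R m + e *\<^sub>R q) ` D"
  assumes dom: "D' \<subseteq> dom_grad F"
  shows "\<exists>P y. (\<forall>a\<in>A. e / card A \<le> P a \<and> P a \<le> 1) \<and> (\<forall>a. a \<notin> A \<longrightarrow> P a = 0) \<and> sum P A = 1 \<and>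
    (\<forall>a \<sigma>. y a \<sigma> \<in> D') \<and>
    (\<Sum>w\<in>set_pmf \<nu>. pmf \<nu> w * (\<Sum>a\<in>A. P a * ((a - snd w) \<bullet> loss (fst w) +
      (snd w \<bullet> (grad F q - grad F (y a (Phi a (fst w)))) +
        grad F (y a (Phi a (fst w))) \<bullet> y a (Phi a (fst w)) - Fr (y a (Phi a (fst w))) -
        grad F q \<bullet> q + Fr q) / \<eta>))) \<le> c + e * (2 + \<bar>c\<bar>)"
proof -
  define T where "T w = (fst w, (1 - e) *\<^sub>R snd w + e *\<^sub>R q)" for w :: "'z \<times> (real ^ 'n)"
  define \<nu>' where "\<nu>' = map_pmf T \<nu>"
  have fin: "finite (set_pmf \<nu>)" and sub: "set_pmf \<nu> \<subseteq> Z \<times> D"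
    using \<nu> by (auto simp: V_def)
  have one: "(\<Sum>w\<in>set_pmf \<nu>. pmf \<nu> w) = 1"
    using fin by (simp add: sum_pmf_eq_1)
  have transfer: "(\<Sum>w\<in>set_pmf \<nu>'. pmf \<nu>' w * h w) = (\<Sum>w\<in>set_pmf \<nu>. pmf \<nu> w * h (T w))" for h :: "_ \<Rightarrow> real"
    unfolding \<nu>'_def by (rule sum_map_pmf_finite[OF fin])
  have D'_D: "D' \<subseteq> D"
    using convexD_alt[OF convex_D _ q(1)] e by (auto simp: D'_def)
  have conv: "convex D'"
  proof -
    have "D' = (\<lambda>x. e *\<^sub>R q + (1 - e) *\<^sub>R x) ` D"
      by (simp add: D'_def add.commute)
    then show ?thesis
      using convex_affinity[OF convex_D] by simp
  qed
  have supp: "set_pmf \<nu>' = T ` set_pmf \<nu>" "finite (set_pmf \<nu>')"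
    using fin by (auto simp: \<nu>'_def)
  have snd': "snd ` set_pmf \<nu>' \<subseteq> D'"
    using sub by (auto simp: supp T_def D'_def)
  have "\<nu>' \<in> V"
    using fin sub D'_D by (auto simp: V_def supp T_def D'_def image_subset_iff)
  \<comment> \<open>For signals of probability zero the conditional law is meaningless; the default
    \<open>q\<close> keeps \<open>y\<close> in \<open>D'\<close> everywhere.\<close>
  define y where "y a \<sigma> = (if set_pmf \<nu>' \<inter> {w. Phi a (fst w) = \<sigma>} = {} then q
    else measure_pmf.expectation (cond_pmf \<nu>' {w. Phi a (fst w) = \<sigma>}) snd)" for a \<sigma>
  have "q \<in> D'"
    using q(1) by (auto simp: D'_def algebra_simps intro: image_eqI[of _ _ q])
  have yD: "y a \<sigma> \<in> D'" for a \<sigma>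
  proof (cases "set_pmf \<nu>' \<inter> {w. Phi a (fst w) = \<sigma>} = {}")
    case False
    then have "measure_pmf.expectation (cond_pmf \<nu>' {w. Phi a (fst w) = \<sigma>}) snd \<in> D'"
      using supp(2) conv snd' by (intro expectation_in_convex) auto
    with False show ?thesis by (simp add: y_def)
  qed (simp add: y_def \<open>q \<in> D'\<close>)
  have y_eq: "pmf_cond_exp \<nu>' snd (\<lambda>w. Phi a (fst w)) w = y a (Phi a (fst w))" if "w \<in> set_pmf \<nu>'" for a w
    using that unfolding pmf_cond_exp_def y_def by auto
  define d where "d a \<sigma> = Fr (y a \<sigma>) - Fr q - grad F q \<bullet> (y a \<sigma> - q)" for a \<sigma>
  define R where "R a = (\<Sum>w\<in>set_pmf \<nu>. pmf \<nu> w *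
    ((a - snd (T w)) \<bullet> loss (fst w) - d a (Phi a (fst w)) / \<eta>))" for a
  obtain p where p: "p \<in> Prob" and "(\<Sum>a\<in>A. pmf p a * (\<Sum>w\<in>set_pmf \<nu>'. pmf \<nu>' w *
      ((a - snd w) \<bullet> loss (fst w) - (Fr (pmf_cond_exp \<nu>' snd (\<lambda>w. Phi a (fst w)) w) - Fr q -
        grad F q \<bullet> (pmf_cond_exp \<nu>' snd (\<lambda>w. Phi a (fst w)) w - q)) / \<eta>))) \<le> c"
    unfolding c_def
    by (rule information_ratio_linearised[OF ratio param \<open>\<nu>' \<in> V\<close> q(2) conv dom snd'])
  moreover have "(\<Sum>w\<in>set_pmf \<nu>'. pmf \<nu>' w *
      ((a - snd w) \<bullet> loss (fst w) - (Fr (pmf_cond_exp \<nu>' snd (\<lambda>w. Phi a (fst w)) w) - Fr q -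
        grad F q \<bullet> (pmf_cond_exp \<nu>' snd (\<lambda>w. Phi a (fst w)) w - q)) / \<eta>)) = R a" for a
  proof -
    have "R a = (\<Sum>w\<in>set_pmf \<nu>'. pmf \<nu>' w *
        ((a - snd w) \<bullet> loss (fst w) - d a (Phi a (fst w)) / \<eta>))"
      unfolding transfer by (simp add: R_def T_def)
    then show ?thesis
      using y_eq by (auto simp: d_def intro!: sum.cong)
  qed
  ultimately have R_le: "(\<Sum>a\<in>A. pmf p a * R a) \<le> c"
    by simp
  have d_nonneg: "0 \<le> d a \<sigma>" for a \<sigma>
    using gradient_inequality[OF F_proper F_convex q(2) F_finite_D, of "y a \<sigma>"] yD D'_D
    by (auto simp: d_def algebra_simps)
  \<comment> \<open>This crude bound pays for the uniform exploration of weight \<open>e\<close> in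
    \<open>P\<close> below.\<close>
  have R_1: "R a \<le> 1" if a: "a \<in> A" for a
  proof -
    have "(a - snd (T w)) \<bullet> loss (fst w) - d a (Phi a (fst w)) / \<eta> \<le> 1" if "w \<in> set_pmf \<nu>" for w
    proof -
      have "fst w \<in> Z" "snd (T w) \<in> D"
        using that sub snd' D'_D by (auto simp: supp)
      then have "(a - snd (T w)) \<bullet> loss (fst w) \<le> 1"
        using inner_loss[OF a, of "fst w"] loss_D[of "snd (T w)" "fst w"] by (simp add: inner_diff_left)
      moreover have "0 \<le> d a (Phi a (fst w)) / \<eta>"
        using d_nonneg param by simp
      ultimately show ?thesis by linarith
    qed
    then have "R a \<le> (\<Sum>w\<in>set_pmf \<nu>. pmf \<nu> w * 1)"
      unfolding R_def by (intro sum_mono mult_left_mono) auto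
    then show ?thesis by (simp add: one)
  qed
  have card: "0 < real (card A)"
    using card_A by simp
  \<comment> \<open>Mixing with the uniform law keeps the weights away from 0, by an amount
    independent of \<open>\<nu>\<close>.\<close>
  define P where "P a = (if a \<in> A then (1 - e) * pmf p a + e / card A else 0)" for a
  define J where "J a w = (a - snd w) \<bullet> loss (fst w) +
      (snd w \<bullet> (grad F q - grad F (y a (Phi a (fst w)))) +
        grad F (y a (Phi a (fst w))) \<bullet> y a (Phi a (fst w)) - Fr (y a (Phi a (fst w))) -
        grad F q \<bullet> q + Fr q) / \<eta>" for a w
  have J_le: "(\<Sum>w\<in>set_pmf \<nu>. pmf \<nu> w * J a w) \<le> R a + e" for a
  proof -
    define v where "v \<sigma> = grad F q - grad F (y a \<sigma>)" for \<sigma>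
    \<comment> \<open>Monotonicity of the gradient, from the gradient inequalities at
      \<open>q\<close> and at \<open>y\<close>.\<close>
    have mono: "(y a \<sigma> - q) \<bullet> v \<sigma> \<le> 0" for \<sigma>
    proof -
      have "Fr q + grad F q \<bullet> (y a \<sigma> - q) \<le> Fr (y a \<sigma>)"
        using yD D'_D by (intro gradient_inequality F_proper F_convex F_finite_D q) auto
      moreover have "Fr (y a \<sigma>) + grad F (y a \<sigma>) \<bullet> (q - y a \<sigma>) \<le> Fr q"
        using yD dom by (intro gradient_inequality F_proper F_convex F_finite_D q) auto
      ultimately show ?thesis by (simp add: v_def algebra_simps inner_commute)
    qed
    \<comment> \<open>The tower property is exact for the shifted law. Undoing the shift leaves
      \<open>e\<close> times the average of \<open>(y - q) \<bullet> v\<close>, which has the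
      favourable sign by \<open>mono\<close>, so the size of the gradients does not enter the
      error.\<close>
    have tower: "(\<Sum>w\<in>set_pmf \<nu>. pmf \<nu> w * (snd w \<bullet> v (Phi a (fst w)))) \<le>
        (\<Sum>w\<in>set_pmf \<nu>. pmf \<nu> w * (y a (Phi a (fst w)) \<bullet> v (Phi a (fst w))))"
    proof -
      let ?E = "\<lambda>h. \<Sum>w\<in>set_pmf \<nu>. pmf \<nu> w * (h w \<bullet> v (Phi a (fst w)))"
      have "(\<Sum>w\<in>set_pmf \<nu>'. pmf \<nu>' w * (snd w \<bullet> v (Phi a (fst w)))) =
          (\<Sum>w\<in>set_pmf \<nu>'. pmf \<nu>' w * (y a (Phi a (fst w)) \<bullet> v (Phi a (fst w))))"
        using tower_property[OF supp(2), of snd v "\<lambda>w. Phi a (fst w)"] y_eq by simp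
      then have eq: "?E (\<lambda>w. (1 - e) *\<^sub>R snd w + e *\<^sub>R q) = ?E (\<lambda>w. y a (Phi a (fst w)))"
        unfolding transfer by (simp add: T_def)
      have "(1 - e) * ?E snd = ?E (\<lambda>w. (1 - e) *\<^sub>R snd w + e *\<^sub>R q) - e * ?E (\<lambda>_. q)"
        by (simp add: sum_distrib_left sum_subtractf[symmetric] algebra_simps)
      also have "\<dots> = (1 - e) * ?E (\<lambda>w. y a (Phi a (fst w))) + e * ?E (\<lambda>w. y a (Phi a (fst w)) - q)"
        unfolding eq by (simp add: inner_diff_left right_diff_distrib left_diff_distrib sum_subtractf)
      also have "\<dots> \<le> (1 - e) * ?E (\<lambda>w. y a (Phi a (fst w)))"
        using mono e by (simp add: mult_nonneg_nonpos sum_nonpos)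
      finally show ?thesis
        using e by simp
    qed
    have "(\<Sum>w\<in>set_pmf \<nu>. pmf \<nu> w * J a w) \<le>
        (\<Sum>w\<in>set_pmf \<nu>. pmf \<nu> w * ((a - snd (T w)) \<bullet> loss (fst w) - d a (Phi a (fst w)) / \<eta> + e) +
          (pmf \<nu> w * (snd w \<bullet> v (Phi a (fst w))) - pmf \<nu> w * (y a (Phi a (fst w)) \<bullet> v (Phi a (fst w)))) / \<eta>)"
    proof (rule sum_mono)
      fix w assume "w \<in> set_pmf \<nu>"
      then have w: "fst w \<in> Z" "snd w \<in> D" using sub by auto
      let ?y = "y a (Phi a (fst w))" and ?l = "loss (fst w)"
      have "(q - snd w) \<bullet> ?l \<le> 1"
        using loss_D[OF q(1) w(1)] loss_D[OF w(2,1)] by (simp add: inner_diff_left)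
      then have "e * ((q - snd w) \<bullet> ?l) \<le> e"
        using e by (simp add: mult_left_le)
      \<comment> \<open>Shifting the comparator changes the regret by
        \<open>e * ((q - snd w) \<bullet> ?l)\<close>.\<close>
      then have 1: "(a - snd w) \<bullet> ?l \<le> (a - snd (T w)) \<bullet> ?l + e"
        by (simp add: T_def algebra_simps)
      \<comment> \<open>Up to a remainder controlled by \<open>tower\<close>, the bracket is minus
        the divergence of \<open>y\<close> from \<open>q\<close>.\<close>
      have "snd w \<bullet> (grad F q - grad F ?y) + grad F ?y \<bullet> ?y - Fr ?y - grad F q \<bullet> q + Fr q =
          - d a (Phi a (fst w)) + (snd w \<bullet> v (Phi a (fst w)) - ?y \<bullet> v (Phi a (fst w)))"
        by (simp add: d_def v_def algebra_simps inner_commute)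
      then have "J a w \<le> ((a - snd (T w)) \<bullet> ?l - d a (Phi a (fst w)) / \<eta> + e) +
          (snd w \<bullet> v (Phi a (fst w)) - ?y \<bullet> v (Phi a (fst w))) / \<eta>"
        using 1 by (simp add: J_def add_divide_distrib diff_divide_distrib)
      then have "pmf \<nu> w * J a w \<le> pmf \<nu> w * (((a - snd (T w)) \<bullet> ?l - d a (Phi a (fst w)) / \<eta> + e) +
          (snd w \<bullet> v (Phi a (fst w)) - ?y \<bullet> v (Phi a (fst w))) / \<eta>)"
        by (rule mult_left_mono) simp
      then show "pmf \<nu> w * J a w \<le> pmf \<nu> w * ((a - snd (T w)) \<bullet> ?l - d a (Phi a (fst w)) / \<eta> + e) +
          (pmf \<nu> w * (snd w \<bullet> v (Phi a (fst w))) - pmf \<nu> w * (?y \<bullet> v (Phi a (fst w)))) / \<eta>"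
        by (simp only: distrib_left right_diff_distrib times_divide_eq_right)
    qed
    also have "\<dots> = R a + e + ((\<Sum>w\<in>set_pmf \<nu>. pmf \<nu> w * (snd w \<bullet> v (Phi a (fst w)))) -
        (\<Sum>w\<in>set_pmf \<nu>. pmf \<nu> w * (y a (Phi a (fst w)) \<bullet> v (Phi a (fst w))))) / \<eta>"
      unfolding sum.distrib distrib_left[of _ _ e] sum_divide_distrib[symmetric] sum_subtractf
        sum_distrib_right[symmetric] one R_def by simp
    also have "\<dots> \<le> R a + e"
      using tower param by (simp add: divide_nonpos_pos)
    finally show ?thesis .
  qed
  have P_sum: "sum P A = 1"
  proof -
    have "sum P A = (1 - e) * sum (pmf p) A + e"
      using card by (simp add: P_def sum.distrib sum_distrib_left)
    then show ?thesis
      using p finite_A by (simp add: sum_pmf_eq_1 Prob_def)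
  qed
  have P_lower: "e / card A \<le> P a" if "a \<in> A" for a
    using that e by (simp add: P_def)
  have P_upper: "P a \<le> 1" if "a \<in> A" for a
    using member_le_sum[OF that, of P] e finite_A by (simp add: P_sum) (simp add: P_def)
  have "(\<Sum>w\<in>set_pmf \<nu>. pmf \<nu> w * (\<Sum>a\<in>A. P a * J a w)) =
      (\<Sum>a\<in>A. P a * (\<Sum>w\<in>set_pmf \<nu>. pmf \<nu> w * J a w))"
    unfolding sum_distrib_left by (subst sum.swap) (simp add: mult.left_commute)
  also have "\<dots> \<le> (\<Sum>a\<in>A. P a * (R a + e))"
    using e card by (intro sum_mono mult_left_mono J_le) (auto simp: P_def)
  also have "\<dots> = (\<Sum>a\<in>A. P a * R a) + e"
    unfolding distrib_left sum.distrib sum_distrib_right[symmetric] P_sum by simp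
  also have "(\<Sum>a\<in>A. P a * R a) = (1 - e) * (\<Sum>a\<in>A. pmf p a * R a) + (\<Sum>a\<in>A. (e / card A) * R a)"
    by (simp add: P_def distrib_right sum.distrib sum_distrib_left mult.assoc)
  also have "\<dots> \<le> (1 - e) * c + (\<Sum>a\<in>A. (e / card A) * 1)"
    using e card R_le R_1 by (intro add_mono mult_left_mono sum_mono) auto
  \<comment> \<open>The error collects \<open>e\<close> from the shifted comparator and
    \<open>e * (1 - c)\<close> from the exploration.\<close>
  also have "(1 - e) * c + (\<Sum>a\<in>A. (e / card A) * 1) + e = c + e * (2 - c)"
    using card by (simp add: algebra_simps)
  also have "\<dots> \<le> c + e * (2 + \<bar>c\<bar>)"
    using e by (simp add: mult_left_mono)
  finally have "(\<Sum>w\<in>set_pmf \<nu>. pmf \<nu> w * (\<Sum>a\<in>A. P a * J a w)) \<le> c + e * (2 + \<bar>c\<bar>)"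
    by simp
  then show ?thesis
    using P_lower P_upper P_sum yD unfolding J_def by (intro exI[of _ P] exI[of _ y]) (simp add: P_def)
qed

section \<open>From affine minorants back to the objective\<close>

text \<open>The hypothesis bounds the objective with each conjugate replaced by its value at a test
  point \<open>x a\<close>. As these points are independent across actions,
  \<open>separable_sup\<close> allows the supremum to be taken for each action, which restores the
  conjugates.\<close>

lemma Lambda_le:
  assumes q: "q \<in> dom_grad F" and \<eta>: "0 < \<eta>" and p: "set_pmf p = A"
    and le: "\<And>x. (\<And>a. x a \<in> edom F) \<Longrightarrow>
      (\<Sum>a\<in>A. pmf p a * ((a - a') \<bullet> loss z + (grad F q \<bullet> x a - Fr (x a) - (grad F q \<bullet> q - Fr q)) / \<eta>) +
        g a (Phi a z) \<bullet> (a' - x a)) \<le> c"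
  shows "Lambda q \<eta> z a' p g \<le> ereal c"
proof -
  define h where "h a = g a (Phi a z)" for a
  define c0 where "c0 = grad F q \<bullet> q - Fr q"
  define u where "u a = grad F q - (\<eta> / pmf p a) *\<^sub>R h a" for a
  define k where "k a = pmf p a * ((a - a') \<bullet> loss z - c0 / \<eta>) + h a \<bullet> a'" for a
  define m where "m a = pmf p a / \<eta>" for a
  define t where "t a x = u a \<bullet> x - Fr x" for a x
  have pos: "0 < pmf p a" if "a \<in> A" for a
    using that p by (auto simp: pmf_positive)
  \<comment> \<open>Isolates the dependence on the test point: \<open>u a\<close> is the argument at
    which \<open>Psi\<close> evaluates the conjugate, and \<open>m a\<close> is the weight of that
    value.\<close>
  have split: "pmf p a * ((a - a') \<bullet> loss z + (grad F q \<bullet> x - Fr x - (grad F q \<bullet> q - Fr q)) / \<eta>) +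
      g a (Phi a z) \<bullet> (a' - x) = k a + m a * t a x" if "a \<in> A" for a x
    using pos[OF that] \<eta>
    by (simp add: k_def m_def t_def u_def h_def c0_def inner_diff_left inner_diff_right)
      (simp add: field_simps)
  have ne: "edom F \<noteq> {}"
    using F_proper by (auto simp: proper_def)
  have sum_le: "(\<Sum>a\<in>A. m a * t a (x a)) \<le> c - sum k A" if "\<And>a. x a \<in> edom F" for x
    using le[of x, OF that] by (simp add: split sum.distrib cong: sum.cong)
  have m_pos: "0 < m a" if "a \<in> A" for a
    using pos[OF that] \<eta> by (simp add: m_def)
  have "\<exists>s. (\<forall>a\<in>A. \<forall>x\<in>edom F. t a x \<le> s a) \<and> (\<Sum>a\<in>A. m a * s a) \<le> c - sum k A"
    by (rule separable_sup[OF finite_A ne m_pos sum_le])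
  then obtain s where s: "\<And>a x. a \<in> A \<Longrightarrow> x \<in> edom F \<Longrightarrow> t a x \<le> s a"
    and s_le: "(\<Sum>a\<in>A. m a * s a) \<le> c - sum k A"
    by blast
  have conj: "conjugate F (u a) \<le> ereal (s a)" if a: "a \<in> A" for a
    unfolding conjugate_def
  proof (rule SUP_least)
    fix x
    show "ereal (u a \<bullet> x) - F x \<le> ereal (s a)"
    proof (cases "F x < \<infinity>")
      case True
      then obtain r where r: "F x = ereal r"
        using proper_finite[OF F_proper] by blast
      have "t a x \<le> s a"
        using True by (intro s a) (simp add: edom_def)
      then show ?thesis by (simp add: t_def r)
    qed auto
  qed
  have Psi: "Psi q ((\<eta> / pmf p a) *\<^sub>R h a) \<le> ereal (s a - c0 + \<eta> / pmf p a * (q \<bullet> h a))" if a: "a \<in> A" for a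
  proof -
    have "Psi q ((\<eta> / pmf p a) *\<^sub>R h a) \<le>
        conjugate F (u a) - conjugate F (grad F q) - ereal (q \<bullet> (u a - grad F q))"
      unfolding Psi_def u_def[symmetric] by (rule bregman_conjugate_le[OF F_proper F_convex q])
    also have "\<dots> \<le> ereal (s a) - ereal c0 - ereal (q \<bullet> (u a - grad F q))"
      unfolding conjugate_grad[OF F_proper F_convex q] c0_def
      by (intro ereal_minus_mono conj[OF a] order.refl)
    finally show ?thesis by (simp add: u_def)
  qed
  have "(\<Sum>a\<in>A. ereal (pmf p a) * Psi q ((\<eta> / pmf p a) *\<^sub>R h a)) \<le>
      (\<Sum>a\<in>A. ereal (pmf p a) * ereal (s a - c0 + \<eta> / pmf p a * (q \<bullet> h a)))"
    by (intro sum_mono ereal_mult_left_mono Psi) auto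
  also have "\<dots> = ereal (\<Sum>a\<in>A. pmf p a * (s a - c0 + \<eta> / pmf p a * (q \<bullet> h a)))"
    by simp
  finally have sum_Psi: "(\<Sum>a\<in>A. ereal (pmf p a) * Psi q ((\<eta> / pmf p a) *\<^sub>R h a)) \<le>
      ereal (\<Sum>a\<in>A. pmf p a * (s a - c0 + \<eta> / pmf p a * (q \<bullet> h a)))" .
  have "Lambda q \<eta> z a' p g \<le> ereal (\<Sum>a\<in>A. pmf p a * ((a - a') \<bullet> loss z)) + ereal ((a' - q) \<bullet> (\<Sum>a\<in>A. h a)) +
      ereal (1 / \<eta>) * ereal (\<Sum>a\<in>A. pmf p a * (s a - c0 + \<eta> / pmf p a * (q \<bullet> h a)))"
    unfolding Lambda_def h_def[symmetric]
    using \<eta> by (intro add_mono order.refl ereal_mult_left_mono sum_Psi) auto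
  also have "\<dots> = ereal ((\<Sum>a\<in>A. pmf p a * ((a - a') \<bullet> loss z)) + (a' - q) \<bullet> (\<Sum>a\<in>A. h a) +
      1 / \<eta> * (\<Sum>a\<in>A. pmf p a * (s a - c0 + \<eta> / pmf p a * (q \<bullet> h a))))"
    by simp
  also have "(\<Sum>a\<in>A. pmf p a * ((a - a') \<bullet> loss z)) + (a' - q) \<bullet> (\<Sum>a\<in>A. h a) +
      1 / \<eta> * (\<Sum>a\<in>A. pmf p a * (s a - c0 + \<eta> / pmf p a * (q \<bullet> h a))) = (\<Sum>a\<in>A. k a + m a * s a)"
    unfolding inner_sum_right sum_distrib_left sum.distrib[symmetric]
  proof (rule sum.cong[OF refl])
    fix a assume "a \<in> A"
    from pos[OF this] \<eta> show "pmf p a * ((a - a') \<bullet> loss z) + (a' - q) \<bullet> h a +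
        1 / \<eta> * (pmf p a * (s a - c0 + \<eta> / pmf p a * (q \<bullet> h a))) = k a + m a * s a"
      \<comment> \<open>The linear term of the divergence contributes
        \<open>q \<bullet> h a\<close>, which cancels the \<open>q\<close> in
        \<open>(a' - q) \<bullet> h a\<close>.\<close>
      by (simp add: k_def m_def inner_diff_left) (simp add: field_simps inner_commute)
  qed
  also have "\<dots> \<le> c"
    using s_le by (simp add: sum.distrib)
  finally show ?thesis by simp
qed

text \<open>A single \<open>(p, g)\<close> good for all indices is obtained from
  \<open>affine_minimax\<close>, whose mixture hypothesis is
  \<open>finite_mixture_bound\<close>.\<close>

lemma Lambda_star_at_le:
  assumes ratio: "has_information_ratio \<alpha> \<beta> lam" and param: "0 \<le> \<beta>" "1 < lam" "0 < \<eta>"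
    and q: "q \<in> D" "q \<in> dom_grad F" and e: "0 < e" "e < 1"
  defines "c \<equiv> \<alpha> + \<beta> * (1 - 1 / lam) * (\<eta> / lam) powr (1 / (lam - 1))"
  shows "Lambda_star_at q \<eta> \<le> ereal (c + e * (2 + \<bar>c\<bar>))"
proof -
  obtain B where B: "\<And>x. x \<in> D \<Longrightarrow> \<bar>Fr x\<bar> \<le> B"
    using F_bounded_D by blast
  have q_int: "q \<in> interior (edom F)"
    using q(2) by (simp add: dom_grad_def)
  define D' where "D' = (\<lambda>m. (1 - e) *\<^sub>R m + e *\<^sub>R q) ` D"
  obtain R where R: "\<And>m. m \<in> D \<Longrightarrow> (1 - e) *\<^sub>R m + e *\<^sub>R q \<in> dom_grad F"
    "\<And>m. m \<in> D \<Longrightarrow> norm (grad F ((1 - e) *\<^sub>R m + e *\<^sub>R q)) \<le> R"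
    using interior_segment_gradient_bound[OF F_proper F_convex F_smooth convex_D D_dom B q(1) q_int e] by metis
  have D'_dom: "D' \<subseteq> dom_grad F" and D'_R: "\<And>y. y \<in> D' \<Longrightarrow> norm (grad F y) \<le> R"
    using R by (auto simp: D'_def)
  have D'_fin: "F y < \<infinity>" if "y \<in> D'" for y
    using D'_dom that by (intro dom_grad_finite) auto
  have "0 \<le> R"
    using R(2)[OF q(1)] norm_ge_zero by (rule order.trans[rotated])
  have card: "0 < real (card A)"
    using card_A by simp
  \<comment> \<open>Bounds \<open>P a * (grad F q - grad F y) / \<eta>\<close> for all
    \<open>P a \<le> 1\<close> and \<open>y\<close> in \<open>D'\<close>, whatever the mixture
    is.\<close>
  define R' where "R' = (norm (grad F q) + R) / \<eta>"
  have "0 \<le> R'"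
    using \<open>0 \<le> R\<close> param by (simp add: R'_def)
  \<comment> \<open>A product of compact sets cut by a closed hyperplane; the lower bound on
    \<open>A\<close> forces full support, as \<open>Prob_plus\<close> demands.\<close>
  define KP where "KP = {P. (\<forall>a. P a \<in> (if a \<in> A then {e / card A..1} else {0}))} \<inter> {P. sum P A = (1 :: real)}"
  define KG where "KG = {g :: real ^ 'n \<Rightarrow> 's \<Rightarrow> real ^ 'n. \<forall>a. g a \<in> {h. \<forall>\<sigma>. h \<sigma> \<in> cball 0 R'}}"
  \<comment> \<open>An index holds the latent state, the comparator and one test point per action;
    for a fixed index, \<open>L\<close> is affine in \<open>(P, g)\<close>.\<close>
  define I where "I = (Z \<times> D) \<times> {x. \<forall>a :: real ^ 'n. x a \<in> edom F}"
  define L where "L i K = (\<Sum>a\<in>A. fst K a * ((a - snd (fst i)) \<bullet> loss (fst (fst i)) +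
      (grad F q \<bullet> snd i a - Fr (snd i a) - (grad F q \<bullet> q - Fr q)) / \<eta>) +
      snd K a (Phi a (fst (fst i))) \<bullet> (snd (fst i) - snd i a))"
    for i and K :: "(real ^ 'n \<Rightarrow> real) \<times> (real ^ 'n \<Rightarrow> 's \<Rightarrow> real ^ 'n)"
  have "\<exists>K\<in>KP \<times> KG. \<forall>i\<in>I. L i K \<le> c + e * (2 + \<bar>c\<bar>)"
  proof (rule affine_minimax)
    have coord: "continuous_on UNIV (\<lambda>P :: real ^ 'n \<Rightarrow> real. P a)" for a
      by simp
    have "closed {P :: real ^ 'n \<Rightarrow> real. sum P A = 1}"
      by (intro closed_Collect_eq continuous_on_sum coord continuous_on_const)
    moreover have "compact {P. \<forall>a. P a \<in> (if a \<in> A then {e / card A..1} else {0 :: real})}"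
      by (rule compact_function_box) auto
    ultimately have "compact KP"
      unfolding KP_def by (intro compact_Int_closed)
    moreover have "compact KG"
      unfolding KG_def by (intro compact_function_box) auto
    ultimately show "compact (KP \<times> KG)"
      by (rule compact_Times)
    have "(\<lambda>a. if a \<in> A then 1 / card A else 0) \<in> KP"
      using e card finite_A by (auto simp: KP_def divide_right_mono sum.If_cases)
    moreover have "(\<lambda>_ _. 0) \<in> KG"
      using \<open>0 \<le> R'\<close> by (auto simp: KG_def)
    ultimately show "KP \<times> KG \<noteq> {}" by auto
    show "continuous_on UNIV (L i)" for i
    proof -
      have fst_coord: "continuous_on UNIV (\<lambda>K :: (real ^ 'n \<Rightarrow> real) \<times> (real ^ 'n \<Rightarrow> 's \<Rightarrow> real ^ 'n). fst K a)" for a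
        by (rule continuous_on_compose2[OF coord continuous_on_fst[OF continuous_on_id]]) auto
      have "continuous_on UNIV (\<lambda>g :: real ^ 'n \<Rightarrow> 's \<Rightarrow> real ^ 'n. g a \<sigma>)" for a \<sigma>
        using continuous_on_compose2[of UNIV "\<lambda>h :: 's \<Rightarrow> real ^ 'n. h \<sigma>" UNIV "\<lambda>g. g a"] by simp
      then have snd_coord: "continuous_on UNIV
          (\<lambda>K :: (real ^ 'n \<Rightarrow> real) \<times> (real ^ 'n \<Rightarrow> 's \<Rightarrow> real ^ 'n). snd K a \<sigma>)" for a \<sigma>
        by (rule continuous_on_compose2[OF _ continuous_on_snd[OF continuous_on_id]]) auto
      show ?thesis
        unfolding L_def by (intro continuous_intros fst_coord snd_coord)
    qed
    show "\<exists>K''\<in>KP \<times> KG. \<forall>i\<in>I. L i K'' = (1 - t) * L i K + t * L i K'"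
      if K: "K \<in> KP \<times> KG" "K' \<in> KP \<times> KG" and t: "t \<in> {0..1}" for K K' t
    proof
      let ?K = "(\<lambda>a. (1 - t) * fst K a + t * fst K' a, \<lambda>a \<sigma>. (1 - t) *\<^sub>R snd K a \<sigma> + t *\<^sub>R snd K' a \<sigma>)"
      show "\<forall>i\<in>I. L i ?K = (1 - t) * L i K + t * L i K'"
        unfolding L_def sum_distrib_left sum.distrib[symmetric]
        by (intro ballI sum.cong) (auto simp: inner_add_left distrib_left distrib_right mult.assoc
            add_divide_distrib)
      have "(\<lambda>a. (1 - t) * fst K a + t * fst K' a) \<in> KP"
      proof -
        have "(1 - t) * fst K a + t * fst K' a \<in> (if a \<in> A then {e / card A..1} else {0})" for a
        proof -
          have "convex (if a \<in> A then {e / card A..1} else {0 :: real})" by auto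
          moreover have "P a \<in> (if a \<in> A then {e / card A..1} else {0})" if "P \<in> KP" for P
            using that unfolding KP_def by blast
          moreover have "fst K \<in> KP" "fst K' \<in> KP"
            using K by auto
          ultimately have "(1 - t) *\<^sub>R fst K a + t *\<^sub>R fst K' a \<in> (if a \<in> A then {e / card A..1} else {0})"
            using t by (intro convexD_alt) auto
          then show ?thesis by simp
        qed
        moreover have "(\<Sum>a\<in>A. (1 - t) * fst K a + t * fst K' a) = 1"
          using K by (auto simp: KP_def sum.distrib sum_distrib_left[symmetric])
        ultimately show ?thesis by (simp add: KP_def)
      qed
      moreover have "(\<lambda>a \<sigma>. (1 - t) *\<^sub>R snd K a \<sigma> + t *\<^sub>R snd K' a \<sigma>) \<in> KG"
      proof -
        have "g a \<sigma> \<in> cball 0 R'" if "g \<in> KG" for g a \<sigma>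
          using that unfolding KG_def by blast
        moreover have "snd K \<in> KG" "snd K' \<in> KG"
          using K by auto
        ultimately have "(1 - t) *\<^sub>R snd K a \<sigma> + t *\<^sub>R snd K' a \<sigma> \<in> cball 0 R'" for a \<sigma>
          using t by (intro convexD_alt convex_cball) auto
        then show ?thesis unfolding KG_def by blast
      qed
      ultimately show "?K \<in> KP \<times> KG" by simp
    qed
    show "\<exists>K\<in>KP \<times> KG. (\<Sum>i\<in>S. w i * L i K) \<le> c + e * (2 + \<bar>c\<bar>)"
      if S: "finite S" "S \<subseteq> I" and w: "\<And>i. i \<in> S \<Longrightarrow> 0 \<le> w i" "sum w S = 1" for S w
    proof -
      \<comment> \<open>The weights become a law on indices. Its marginal on the first component is
        the law \<open>\<nu>\<close> fed to the information ratio; the test points are disposed of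
        separately.\<close>
      obtain N where N: "\<And>i. pmf N i = (if i \<in> S then w i else 0)"
        using pmf_of_weights[OF S(1) w] by blast
      have NS: "set_pmf N \<subseteq> S"
        by (auto simp: set_pmf_iff N split: if_splits)
      have finN: "finite (set_pmf N)"
        using NS S(1) by (rule finite_subset)
      define \<nu> where "\<nu> = map_pmf fst N"
      have "\<nu> \<in> V"
        using NS S(2) finN by (auto simp: V_def \<nu>_def I_def)
      have weights: "(\<Sum>i\<in>S. w i * h i) = (\<Sum>i\<in>set_pmf N. pmf N i * h i)" for h
        using NS S(1) by (intro sum.mono_neutral_cong_right) (auto simp: set_pmf_iff N split: if_splits)
      define J where "J P y v = (\<Sum>a\<in>A. P a * ((a - snd v) \<bullet> loss (fst v) +
          (snd v \<bullet> (grad F q - grad F (y a (Phi a (fst v)))) +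
            grad F (y a (Phi a (fst v))) \<bullet> y a (Phi a (fst v)) - Fr (y a (Phi a (fst v))) -
            grad F q \<bullet> q + Fr q) / \<eta>))" for P :: "real ^ 'n \<Rightarrow> real" and y and v :: "'z \<times> (real ^ 'n)"
      have "\<exists>P y. (\<forall>a\<in>A. e / card A \<le> P a \<and> P a \<le> 1) \<and> (\<forall>a. a \<notin> A \<longrightarrow> P a = 0) \<and> sum P A = 1 \<and>
          (\<forall>a \<sigma>. y a \<sigma> \<in> D') \<and> (\<Sum>v\<in>set_pmf \<nu>. pmf \<nu> v * J P y v) \<le> c + e * (2 + \<bar>c\<bar>)"
        unfolding J_def using finite_mixture_bound[OF ratio param \<open>\<nu> \<in> V\<close> q e, folded c_def D'_def, OF D'_dom] .
      then obtain P y where P: "\<And>a. a \<in> A \<Longrightarrow> e / card A \<le> P a \<and> P a \<le> 1" "\<And>a. a \<notin> A \<Longrightarrow> P a = 0" "sum P A = 1"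
        and y: "\<And>a \<sigma>. y a \<sigma> \<in> D'"
        and J: "(\<Sum>v\<in>set_pmf \<nu>. pmf \<nu> v * J P y v) \<le> c + e * (2 + \<bar>c\<bar>)"
        by blast
      \<comment> \<open>With this choice the argument of the conjugate in \<open>Psi\<close> is
        \<open>grad F (y a \<sigma>)\<close> wherever \<open>P a\<close> is positive.\<close>
      define g where "g a \<sigma> = (P a / \<eta>) *\<^sub>R (grad F q - grad F (y a \<sigma>))" for a \<sigma>
      have P01: "0 \<le> P a" "P a \<le> 1" for a
        using P e card by (cases "a \<in> A"; force intro: order.trans[of 0 "e / card A"])+
      have "P \<in> KP"
        using P by (auto simp: KP_def)
      moreover have "g \<in> KG"
      proof -
        have "norm (g a \<sigma>) \<le> R'" for a \<sigma>
        proof -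
          have "norm (g a \<sigma>) = P a * norm (grad F q - grad F (y a \<sigma>)) / \<eta>"
            using P01 param by (simp add: g_def)
          also have "\<dots> \<le> 1 * (norm (grad F q) + R) / \<eta>"
            using P01 param D'_R[OF y[of a \<sigma>]] norm_triangle_ineq4[of "grad F q" "grad F (y a \<sigma>)"]
            by (intro divide_right_mono mult_mono) auto
          finally show ?thesis by (simp add: R'_def)
        qed
        then show ?thesis by (simp add: KG_def)
      qed
      moreover have "(\<Sum>i\<in>S. w i * L i (P, g)) \<le> c + e * (2 + \<bar>c\<bar>)"
      proof -
        have "L i (P, g) \<le> J P y (fst i)" if "i \<in> S" for i
          unfolding L_def J_def fst_conv snd_conv
        proof (rule sum_mono)
          fix a assume "a \<in> A"
          let ?y = "y a (Phi a (fst (fst i)))" and ?x = "snd i a" and ?a = "snd (fst i)"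
          have "F ?x < \<infinity>"
            using that S(2) by (auto simp: I_def edom_def)
          \<comment> \<open>The test point \<open>?y\<close> is optimal at the gradient
            \<open>grad F ?y\<close>, so every \<open>?x\<close> can be replaced by it.\<close>
          then have "Fr ?y + grad F ?y \<bullet> (?x - ?y) \<le> Fr ?x"
            using D'_dom y by (intro gradient_inequality F_proper F_convex) auto
          then have "grad F q \<bullet> ?x - Fr ?x - (grad F q \<bullet> q - Fr q) + (grad F q - grad F ?y) \<bullet> (?a - ?x)
              \<le> ?a \<bullet> (grad F q - grad F ?y) + grad F ?y \<bullet> ?y - Fr ?y - grad F q \<bullet> q + Fr q"
            by (simp add: algebra_simps inner_commute)
          then have "P a * ((a - ?a) \<bullet> loss (fst (fst i)) +
              (grad F q \<bullet> ?x - Fr ?x - (grad F q \<bullet> q - Fr q) + (grad F q - grad F ?y) \<bullet> (?a - ?x)) / \<eta>)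
            \<le> P a * ((a - ?a) \<bullet> loss (fst (fst i)) +
              (?a \<bullet> (grad F q - grad F ?y) + grad F ?y \<bullet> ?y - Fr ?y - grad F q \<bullet> q + Fr q) / \<eta>)"
            using P01 param by (intro mult_left_mono add_left_mono divide_right_mono) auto
          then show "P a * ((a - ?a) \<bullet> loss (fst (fst i)) + (grad F q \<bullet> ?x - Fr ?x - (grad F q \<bullet> q - Fr q)) / \<eta>) +
              g a (Phi a (fst (fst i))) \<bullet> (?a - ?x) \<le> P a * ((a - ?a) \<bullet> loss (fst (fst i)) +
              (?a \<bullet> (grad F q - grad F ?y) + grad F ?y \<bullet> ?y - Fr ?y - grad F q \<bullet> q + Fr q) / \<eta>)"
            by (simp add: g_def add_divide_distrib distrib_left)
        qed
        then have "(\<Sum>i\<in>S. w i * L i (P, g)) \<le> (\<Sum>i\<in>S. w i * J P y (fst i))"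
          using w by (intro sum_mono mult_left_mono) auto
        also have "\<dots> = (\<Sum>v\<in>set_pmf \<nu>. pmf \<nu> v * J P y v)"
          unfolding weights \<nu>_def by (rule sum_map_pmf_finite[OF finN, symmetric])
        finally show ?thesis using J by simp
      qed
      ultimately show ?thesis by blast
    qed
  qed
  then obtain P g where P: "P \<in> KP" and L: "\<And>i. i \<in> I \<Longrightarrow> L i (P, g) \<le> c + e * (2 + \<bar>c\<bar>)"
    by auto
  have P_A: "e / card A \<le> P a" if "a \<in> A" for a
    using P that by (auto simp: KP_def dest!: spec[of _ a])
  have P_pos: "0 < P a" if "a \<in> A" for a
    using P_A[OF that] e card by (meson divide_pos_pos order.strict_trans2)
  obtain p where p: "\<And>a. pmf p a = (if a \<in> A then P a else 0)"
    using pmf_of_weights[OF finite_A, of P] P P_pos by (auto simp: KP_def intro: less_imp_le)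
  have set_p: "set_pmf p = A"
  proof -
    have "pmf p a \<noteq> 0 \<longleftrightarrow> a \<in> A" for a
      using P_pos[of a] by (auto simp: p)
    then show ?thesis
      unfolding set_eq_iff set_pmf_iff by blast
  qed
  have "(p, g) \<in> Prob_plus \<times> UNIV"
    using set_p by (simp add: Prob_plus_def)
  then have "Lambda_star_at q \<eta> \<le> (SUP (z, a')\<in>Z \<times> D. Lambda q \<eta> z a' p g)"
    unfolding Lambda_star_at_def by (rule order.trans[OF INF_lower]) (simp only: prod.case order.refl)
  also have "\<dots> \<le> ereal (c + e * (2 + \<bar>c\<bar>))"
  proof (rule SUP_least)
    fix v assume "v \<in> Z \<times> D"
    then obtain z a' where v: "v = (z, a')" and "z \<in> Z" "a' \<in> D"
      by blast
    show "(case v of (z, a') \<Rightarrow> Lambda q \<eta> z a' p g) \<le> ereal (c + e * (2 + \<bar>c\<bar>))"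
      unfolding v prod.case
    proof (rule Lambda_le[OF q(2) param(3) set_p])
      fix x :: "real ^ 'n \<Rightarrow> real ^ 'n"
      assume x: "\<And>a. x a \<in> edom F"
      have "L ((z, a'), x) (P, g) \<le> c + e * (2 + \<bar>c\<bar>)"
        using \<open>z \<in> Z\<close> \<open>a' \<in> D\<close> x by (intro L) (auto simp: I_def)
      then show "(\<Sum>a\<in>A. pmf p a * ((a - a') \<bullet> loss z +
          (grad F q \<bullet> x a - Fr (x a) - (grad F q \<bullet> q - Fr q)) / \<eta>) + g a (Phi a z) \<bullet> (a' - x a)) \<le>
          c + e * (2 + \<bar>c\<bar>)"
        by (simp add: L_def p cong: sum.cong)
    qed
  qed
  finally show ?thesis .
qed

text \<open>The bound for fixed \<open>q\<close> holds for every shift \<open>e\<close> in the open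
  unit interval, and its error vanishes as \<open>e\<close> tends to 0.\<close>

lemma Lambda_star_le:
  assumes "has_information_ratio \<alpha> \<beta> lam" "0 \<le> \<beta>" "1 < lam" "0 < \<eta>"
  shows "Lambda_star \<eta> \<le> ereal (\<alpha> + \<beta> * (1 - 1 / lam) * (\<eta> / lam) powr (1 / (lam - 1)))"
    (is "_ \<le> ereal ?c")
  unfolding Lambda_star_def
proof (rule SUP_least)
  fix q assume q: "q \<in> D \<inter> dom_grad F"
  have "((\<lambda>e. ereal (?c + e * (2 + \<bar>?c\<bar>))) \<longlongrightarrow> ereal (?c + 0 * (2 + \<bar>?c\<bar>))) (at_right 0)"
    by (intro tendsto_intros)
  moreover have "eventually (\<lambda>e. Lambda_star_at q \<eta> \<le> ereal (?c + e * (2 + \<bar>?c\<bar>))) (at_right 0)"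
    using eventually_at_right_real[of 0 1, OF zero_less_one]
  proof eventually_elim
    case (elim e)
    then show ?case
      using q by (intro Lambda_star_at_le assms) auto
  qed
  ultimately have "Lambda_star_at q \<eta> \<le> ereal (?c + 0 * (2 + \<bar>?c\<bar>))"
    by (rule tendsto_lowerbound) simp
  then show "Lambda_star_at q \<eta> \<le> ereal ?c" by simp
qed

end

theorem theorem9:
  fixes A :: "(real ^ 'n) set"
    and Sig :: "'s set"
    and Z :: "'z set"
    and Phi :: "real ^ 'n \<Rightarrow> 'z \<Rightarrow> 's"
    and loss :: "'z \<Rightarrow> real ^ 'n"
    and F :: "real ^ 'n \<Rightarrow> ereal"
    and D :: "(real ^ 'n) set"
    and \<alpha> \<beta> lam \<eta> :: real
  assumes "linear_pm_game A Sig Z Phi loss F D"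
    and "0 \<le> \<beta>"
    and "1 < lam"
    and "linear_pm_game.has_information_ratio A Z Phi loss F D \<alpha> \<beta> lam"
    and "0 < \<eta>"
  shows "linear_pm_game.Lambda_star A Z Phi loss F D \<eta>
           \<le> ereal (\<alpha> + \<beta> * (1 - 1 / lam) * (\<eta> / lam) powr (1 / (lam - 1)))"
  by (rule linear_pm_game.Lambda_star_le[OF assms(1,4,2,3,5)])

end
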